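(* Let $\mathfrak{g}$ be a Kac–Moody algebra of finite or affine type with Weyl group $W$, let $\lambda\in P^+$ be a dominant integral weight, let $B(\lambda)$ be the crystal of the irreducible highest weight module $V(\lambda)$ with highest weight vertex $b_\lambda$, and let $\mathcal{O}(\lambda)=W b_\lambda$ be the orbit of $b_\lambda$ under the action of $W$ on $B(\lambda)$. Let $b\in\mathcal{O}(\lambda)$ and let $w\in W$ be such that $b=w(b_\lambda)$. Then $\mathscr{L}_\lambda(w)$ equals the depth of $b$ in $B(\lambda)$.
   Context: $\mathfrak{g}$ has simple roots $\alpha_i$ and simple coroots $\alpha_i^\vee$ indexed by $i\in\{1,\dots,n\}$ (finite type) or $i\in\{0,\dots,n\}$ (affine type), and $W$ is generated by the simple reflections $s_i(x)=x-\langle x,\alpha_i^\vee\rangle\alpha_i$ acting on $\mathfrak{h}^*$. $P$ is the weight lattice and $P^+$ the set of dominant integral weights. $\rho^\vee$ denotes an element (the sum of the fundamental coweights) with $\langle\alpha_i,\rho^\vee\rangle=1$ for every simple root $\alpha_i$. The $\lambda$-atomic length of $w\in W$ is $\mathscr{L}_\lambda(w)=\langle\lambda-w(\lambda),\rho^\vee\rangle$. The crystal $B(\lambda)$ is the (Kashiwara) crystal graph of the integrable highest weight module $V(\lambda)$: a connected oriented graph with arrows coloured by the index set, with a unique source vertex $b_\lambda$, and a weight function $\mathrm{wt}:B(\lambda)\to P$ with $\mathrm{wt}(b_\lambda)=\lambda$ and $\mathrm{wt}(b)=\mathrm{wt}(b')-\alpha_i$ whenever there is an arrow $b'\xrightarrow{i}b$.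 It satisfies $\langle\mathrm{wt}(b),\alpha_i^\vee\rangle=\varphi_i(b)-\varepsilon_i(b)$, where $\varphi_i(b)$ (resp. $\varepsilon_i(b)$) is the length of the string of $i$-arrows going out of (resp. into) $b$. Every vertex is reached from $b_\lambda$ by a directed path, and the depth of a vertex $b$ is the number of arrows in any directed path from $b_\lambda$ to $b$. The Weyl group acts on $B(\lambda)$ as follows: $s_i$ sends a vertex $b$ to its mirror image with respect to the middle of the $i$-string (maximal chain of $i$-arrows) containing $b$. *)

theory Defs
  imports "HOL-Analysis.Analysis" "HOL-Computational_Algebra.Polynomial" "HOL-Computational_Algebra.Fraction_Field"
begin

section \<open>Generalized Cartan matrices of finite and affine type\<close>

definition gcm :: "int^'i^'i \<Rightarrow> bool" where
  "gcm A \<longleftrightarrow> (\<forall>i. A $ i $ i = 2) \<and> (\<forall>i j. i \<noteq> j \<longrightarrow> A $ i $ j \<le> 0) \<and>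
     (\<forall>i j. A $ i $ j = 0 \<longrightarrow> A $ j $ i = 0)"

definition indecomposable :: "int^'i^'i \<Rightarrow> bool" where
  "indecomposable A \<longleftrightarrow>
     \<not> (\<exists>S. S \<noteq> {} \<and> S \<noteq> UNIV \<and> (\<forall>i\<in>S. \<forall>j\<in>-S. A $ i $ j = 0 \<and> A $ j $ i = 0))"

text \<open>
  Kac's trichotomy, in the form of the criteria \<open>A u > 0\<close> and \<open>A u = 0\<close> for some \<open>u > 0\<close>
  (Infinite-dimensional Lie algebras, Theorem 4.3 and Corollary 4.3). Indecomposability is not
  imposed in finite type, so that semisimple, not only simple, Lie algebras are included.
\<close>

definition finite_type :: "int^'i^'i \<Rightarrow> bool" where
  "finite_type A \<longleftrightarrow> gcm A \<and>
     (\<exists>u::'i \<Rightarrow> real. (\<forall>i. u i > 0) \<and> (\<forall>i. (\<Sum>j\<in>UNIV. of_int (A $ i $ j) * u j) > 0))"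

definition affine_type :: "int^'i^'i \<Rightarrow> bool" where
  "affine_type A \<longleftrightarrow> gcm A \<and> indecomposable A \<and>
     (\<exists>u::'i \<Rightarrow> real. (\<forall>i. u i > 0) \<and> (\<forall>i. (\<Sum>j\<in>UNIV. of_int (A $ i $ j) * u j) = 0))"


section \<open>Root data of Kac--Moody algebras\<close>

text \<open>
  Both \<open>\<hh>\<^sup>*\<close> and \<open>\<hh>\<close> are modelled by \<open>complex^'r\<close>, in dual coordinates. The positive integers
  \<open>symm D i\<close> symmetrize the Cartan matrix; they enter the quantum group via \<open>q\<^sub>i = q ^ symm D i\<close>.
\<close>

record ('i::finite, 'r::finite) root_datum =
  cartan :: "int^'i^'i"
  simple_root :: "'i \<Rightarrow> complex^'r"
  simple_coroot :: "'i \<Rightarrow> complex^'r"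
  symm :: "'i \<Rightarrow> nat"

definition pairing :: "complex^'r \<Rightarrow> complex^'r \<Rightarrow> complex" where
  "pairing x h = (\<Sum>k\<in>UNIV. x $ k * h $ k)"

text \<open>A minimal realization of a symmetrizable generalized Cartan matrix.\<close>

definition kac_moody_datum :: "('i::finite, 'r::finite) root_datum \<Rightarrow> bool" where
  "kac_moody_datum D \<longleftrightarrow>
     gcm (cartan D) \<and>
     (\<forall>i. symm D i > 0) \<and>
     (\<forall>i j. int (symm D i) * cartan D $ i $ j = int (symm D j) * cartan D $ j $ i) \<and>
     inj (simple_root D) \<and> vec.independent (range (simple_root D)) \<and>
     inj (simple_coroot D) \<and> vec.independent (range (simple_coroot D)) \<and>
     (\<forall>i j. pairing (simple_root D j) (simple_coroot D i) = of_int (cartan D $ i $ j)) \<and>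
     CARD('r) + rank ((\<chi> i j. of_int (cartan D $ i $ j)) :: complex^'i^'i) = 2 * CARD('i)"

definition weight_lattice :: "('i::finite, 'r::finite) root_datum \<Rightarrow> (complex^'r) set" where
  "weight_lattice D = {\<mu>. \<forall>i. pairing \<mu> (simple_coroot D i) \<in> \<int>}"

definition dominant_weights :: "('i::finite, 'r::finite) root_datum \<Rightarrow> (complex^'r) set" where
  "dominant_weights D = {\<mu>. \<forall>i. pairing \<mu> (simple_coroot D i) \<in> \<nat>}"

definition simple_reflection :: "('i::finite, 'r::finite) root_datum \<Rightarrow> 'i \<Rightarrow> complex^'r \<Rightarrow> complex^'r" where
  "simple_reflection D i x = x - pairing x (simple_coroot D i) *s simple_root D i"

text \<open>The simple reflections are involutions, so closing under products gives the group.\<close>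

inductive_set weyl_group :: "('i::finite, 'r::finite) root_datum \<Rightarrow> (complex^'r \<Rightarrow> complex^'r) set"
  for D where
  "id \<in> weyl_group D"
| "w \<in> weyl_group D \<Longrightarrow> simple_reflection D i \<circ> w \<in> weyl_group D"

definition atomic_length ::
    "complex^'r \<Rightarrow> complex^'r \<Rightarrow> (complex^'r \<Rightarrow> complex^'r) \<Rightarrow> complex" where
  "atomic_length \<rho> \<Lambda> w = pairing (\<Lambda> - w \<Lambda>) \<rho>"


section \<open>Quantum integers\<close>

type_synonym ratfun = "rat poly fract"

definition qvar :: ratfun where
  "qvar = Fract [:0, 1:] 1"

definition rat_const :: "rat \<Rightarrow> ratfun" where
  "rat_const r = Fract [:r:] 1"

text \<open>The local ring of rational functions that are regular at \<open>q = 0\<close>.\<close>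

definition regular_at_0 :: "ratfun set" where
  "regular_at_0 = {Fract a b | a b. poly b 0 \<noteq> 0}"

definition qi :: "('i::finite, 'r::finite) root_datum \<Rightarrow> 'i \<Rightarrow> ratfun" where
  "qi D i = qvar ^ symm D i"

definition qint :: "('i::finite, 'r::finite) root_datum \<Rightarrow> 'i \<Rightarrow> int \<Rightarrow> ratfun" where
  "qint D i m = (qi D i powi m - qi D i powi (- m)) / (qi D i - inverse (qi D i))"

definition qfact :: "('i::finite, 'r::finite) root_datum \<Rightarrow> 'i \<Rightarrow> nat \<Rightarrow> ratfun" where
  "qfact D i n = (\<Prod>k=1..n. qint D i (int k))"


section \<open>Integrable weight modules of the quantum group\<close>

text \<open>
  A \<open>U\<^sub>q(\<gg>)\<close>-module over \<open>\<rat>(q)\<close> with a weight decomposition is given by its weight spaces and the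
  action of the generators \<open>E\<^sub>i\<close>, \<open>F\<^sub>i\<close>: the Cartan part \<open>q\<^sup>h\<close> acts on the space of weight \<open>\<mu>\<close> by
  the scalar \<open>q ^ \<langle>\<mu>, h\<rangle>\<close>, hence carries no further information.
\<close>

record ('i::finite, 'r::finite, 'm) uq_module =
  scl :: "ratfun \<Rightarrow> 'm \<Rightarrow> 'm"
  wsp :: "complex^'r \<Rightarrow> 'm set"
  opE :: "'i \<Rightarrow> 'm \<Rightarrow> 'm"
  opF :: "'i \<Rightarrow> 'm \<Rightarrow> 'm"

text \<open>\<open>c\<close> is the family of weight components of \<open>u\<close>.\<close>

definition weight_decomp ::
    "('i::finite, 'r::finite, 'm::ab_group_add) uq_module \<Rightarrow> 'm \<Rightarrow> (complex^'r \<Rightarrow> 'm) \<Rightarrow> bool" where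
  "weight_decomp V u c \<longleftrightarrow> finite {\<mu>. c \<mu> \<noteq> 0} \<and> (\<forall>\<mu>. c \<mu> \<in> wsp V \<mu>) \<and>
     u = (\<Sum>\<mu> | c \<mu> \<noteq> 0. c \<mu>)"

definition divpow ::
    "('i::finite, 'r::finite) root_datum \<Rightarrow> ('i::finite, 'r::finite, 'm) uq_module \<Rightarrow> ('i \<Rightarrow> 'm \<Rightarrow> 'm) \<Rightarrow> 'i \<Rightarrow> nat \<Rightarrow> 'm \<Rightarrow> 'm" where
  "divpow D V X i n u = scl V (inverse (qfact D i n)) ((X i ^^ n) u)"

definition q_serre ::
    "('i::finite, 'r::finite) root_datum \<Rightarrow> ('i::finite, 'r::finite, 'm::ab_group_add) uq_module \<Rightarrow> ('i \<Rightarrow> 'm \<Rightarrow> 'm) \<Rightarrow> bool" where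
  "q_serre D V X \<longleftrightarrow> (\<forall>i j u. i \<noteq> j \<longrightarrow>
     (let N = nat (1 - cartan D $ i $ j)
      in (\<Sum>k\<le>N. scl V ((- 1) ^ k) (divpow D V X i k (X j (divpow D V X i (N - k) u)))) = 0))"

definition integrable_module ::
    "('i::finite, 'r::finite) root_datum \<Rightarrow> ('i::finite, 'r::finite, 'm::ab_group_add) uq_module \<Rightarrow> bool" where
  "integrable_module D V \<longleftrightarrow>
     vector_space (scl V) \<and>
     (\<forall>\<mu>. module.subspace (scl V) (wsp V \<mu>)) \<and>
     (\<forall>\<mu>. \<mu> \<notin> weight_lattice D \<longrightarrow> wsp V \<mu> = {0}) \<and>
     (\<forall>u. \<exists>!c. weight_decomp V u c) \<and>
     (\<forall>i. Vector_Spaces.linear (scl V) (scl V) (opE V i)) \<and>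
     (\<forall>i. Vector_Spaces.linear (scl V) (scl V) (opF V i)) \<and>
     (\<forall>i \<mu>. opE V i ` wsp V \<mu> \<subseteq> wsp V (\<mu> + simple_root D i)) \<and>
     (\<forall>i \<mu>. opF V i ` wsp V \<mu> \<subseteq> wsp V (\<mu> - simple_root D i)) \<and>
     (\<forall>i j \<mu> m. \<forall>u\<in>wsp V \<mu>. pairing \<mu> (simple_coroot D i) = of_int m \<longrightarrow>
        opE V i (opF V j u) - opF V j (opE V i u) = (if i = j then scl V (qint D i m) u else 0)) \<and>
     q_serre D V (opE V) \<and> q_serre D V (opF V) \<and>
     (\<forall>i u. \<exists>n. (opE V i ^^ n) u = 0) \<and> (\<forall>i u. \<exists>n. (opF V i ^^ n) u = 0)"

definition submodule :: "('i::finite, 'r::finite, 'm::ab_group_add) uq_module \<Rightarrow> 'm set \<Rightarrow> bool" where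
  "submodule V N \<longleftrightarrow> module.subspace (scl V) N \<and>
     (\<forall>u\<in>N. \<forall>c. weight_decomp V u c \<longrightarrow> range c \<subseteq> N) \<and>
     (\<forall>i. opE V i ` N \<subseteq> N) \<and> (\<forall>i. opF V i ` N \<subseteq> N)"

text \<open>\<open>V\<close> is the module \<open>V(\<Lambda>)\<close>, with highest weight vector \<open>v\<close>.\<close>

definition irreducible_hw_module ::
    "('i::finite, 'r::finite) root_datum \<Rightarrow> ('i::finite, 'r::finite, 'm::ab_group_add) uq_module \<Rightarrow> complex^'r \<Rightarrow> 'm \<Rightarrow> bool" where
  "irreducible_hw_module D V \<Lambda> v \<longleftrightarrow>
     integrable_module D V \<and>
     v \<in> wsp V \<Lambda> \<and> v \<noteq> 0 \<and> (\<forall>i. opE V i v = 0) \<and>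
     (\<forall>N. submodule V N \<longrightarrow> N = {0} \<or> N = UNIV)"


section \<open>Kashiwara operators and crystal bases\<close>

text \<open>
  By \<open>U\<^sub>q(sl\<^sub>2)\<close>-theory an integrable module is spanned by the \<open>F\<^sub>i\<^bsup>(n)\<^esup> u\<close> with \<open>u\<close> a weight vector
  killed by \<open>E\<^sub>i\<close> and \<open>0 \<le> n \<le> \<langle>wt u, \<alpha>\<^sub>i\<^sup>\<or>\<rangle>\<close>, and there are unique linear operators with the
  following values on these vectors. The bound on \<open>n\<close> is needed: for
  \<open>n = \<langle>wt u, \<alpha>\<^sub>i\<^sup>\<or>\<rangle> + 1\<close> the vector \<open>F\<^sub>i\<^bsup>(n)\<^esup> u\<close> vanishes but \<open>F\<^sub>i\<^bsup>(n-1)\<^esup> u\<close> does not.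
\<close>

definition kashiwara_f ::
    "('i::finite, 'r::finite) root_datum \<Rightarrow> ('i::finite, 'r::finite, 'm::ab_group_add) uq_module \<Rightarrow> 'i \<Rightarrow> 'm \<Rightarrow> 'm" where
  "kashiwara_f D V i = (THE g. Vector_Spaces.linear (scl V) (scl V) g \<and>
     (\<forall>\<mu> m n u. u \<in> wsp V \<mu> \<and> opE V i u = 0 \<and>
        pairing \<mu> (simple_coroot D i) = of_int m \<and> int n \<le> m \<longrightarrow>
        g (divpow D V (opF V) i n u) = divpow D V (opF V) i (n + 1) u))"

definition kashiwara_e ::
    "('i::finite, 'r::finite) root_datum \<Rightarrow> ('i::finite, 'r::finite, 'm::ab_group_add) uq_module \<Rightarrow> 'i \<Rightarrow> 'm \<Rightarrow> 'm" where
  "kashiwara_e D V i = (THE g. Vector_Spaces.linear (scl V) (scl V) g \<and>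
     (\<forall>\<mu> m n u. u \<in> wsp V \<mu> \<and> opE V i u = 0 \<and>
        pairing \<mu> (simple_coroot D i) = of_int m \<and> int n \<le> m \<longrightarrow>
        g (divpow D V (opF V) i n u) = (if n = 0 then 0 else divpow D V (opF V) i (n - 1) u)))"

definition regular_span ::
    "('i::finite, 'r::finite, 'm::ab_group_add) uq_module \<Rightarrow> 'm set \<Rightarrow> 'm set" where
  "regular_span V X =
     {\<Sum>x\<in>S. scl V (c x) x | S c. finite S \<and> S \<subseteq> X \<and> c ` S \<subseteq> regular_at_0}"

text \<open>The class of \<open>u\<close> in \<open>L/qL\<close>; elements of \<open>L/qL\<close> are treated as cosets in \<open>V\<close>.\<close>

definition qcoset :: "('i::finite, 'r::finite, 'm::ab_group_add) uq_module \<Rightarrow> 'm set \<Rightarrow> 'm \<Rightarrow> 'm set" where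
  "qcoset V L u = {u + scl V qvar l | l. l \<in> L}"

text \<open>
  The operator on \<open>L/qL\<close> induced by a linear operator \<open>g\<close> preserving \<open>L\<close> (the union is over
  equal cosets).
\<close>

definition induced ::
    "('i::finite, 'r::finite, 'm::ab_group_add) uq_module \<Rightarrow> 'm set \<Rightarrow> ('m \<Rightarrow> 'm) \<Rightarrow> 'm set \<Rightarrow> 'm set" where
  "induced V L g b = (\<Union>u\<in>b. qcoset V L (g u))"

text \<open>\<open>L\<close> is a free \<open>A\<close>-module with \<open>\<rat>(q) \<otimes> L = V\<close>, where \<open>A\<close> is the ring \<open>regular_at_0\<close>.\<close>

definition full_lattice :: "('i::finite, 'r::finite, 'm::ab_group_add) uq_module \<Rightarrow> 'm set \<Rightarrow> bool" where
  "full_lattice V L \<longleftrightarrow>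
     (\<exists>X. \<not> module.dependent (scl V) X \<and> module.span (scl V) X = UNIV \<and> L = regular_span V X)"

text \<open>\<open>B\<close> is a \<open>\<rat>\<close>-basis of \<open>L/qL\<close>; here \<open>X\<close> is a system of representatives for \<open>B\<close>.\<close>

definition basis_mod_q ::
    "('i::finite, 'r::finite, 'm::ab_group_add) uq_module \<Rightarrow> 'm set \<Rightarrow> 'm set set \<Rightarrow> bool" where
  "basis_mod_q V L B \<longleftrightarrow>
     (\<exists>X\<subseteq>L. inj_on (qcoset V L) X \<and> B = qcoset V L ` X \<and>
        (\<forall>u\<in>L. \<exists>!c. finite {x. c x \<noteq> 0} \<and> {x. c x \<noteq> 0} \<subseteq> X \<and>
           u \<in> qcoset V L (\<Sum>x | c x \<noteq> 0. scl V (rat_const (c x)) x)))"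

text \<open>Kashiwara's definition of a (lower) crystal base of an integrable module.\<close>

definition crystal_base ::
    "('i::finite, 'r::finite) root_datum \<Rightarrow> ('i::finite, 'r::finite, 'm::ab_group_add) uq_module \<Rightarrow> 'm set \<Rightarrow> 'm set set \<Rightarrow> bool" where
  "crystal_base D V L B \<longleftrightarrow>
     full_lattice V L \<and>
     basis_mod_q V L B \<and>
     (\<forall>u\<in>L. \<forall>c. weight_decomp V u c \<longrightarrow> range c \<subseteq> L) \<and>
     (\<forall>b\<in>B. \<exists>\<mu>. \<exists>u\<in>L \<inter> wsp V \<mu>. b = qcoset V L u) \<and>
     (\<forall>i. kashiwara_e D V i ` L \<subseteq> L \<and> kashiwara_f D V i ` L \<subseteq> L) \<and>
     (\<forall>i. \<forall>b\<in>B. induced V L (kashiwara_e D V i) b \<in> B \<union> {qcoset V L 0} \<and>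
                 induced V L (kashiwara_f D V i) b \<in> B \<union> {qcoset V L 0}) \<and>
     (\<forall>i. \<forall>b\<in>B. \<forall>b'\<in>B. induced V L (kashiwara_f D V i) b = b' \<longleftrightarrow>
                       induced V L (kashiwara_e D V i) b' = b)"

definition f_monomials ::
    "('i::finite, 'r::finite) root_datum \<Rightarrow> ('i::finite, 'r::finite, 'm::ab_group_add) uq_module \<Rightarrow> 'm \<Rightarrow> 'm set" where
  "f_monomials D V v = {foldr (kashiwara_f D V) is v | is. True}"

text \<open>
  \<open>(L, B)\<close> is the crystal base \<open>(L(\<Lambda>), B(\<Lambda>))\<close> of \<open>V = V(\<Lambda>)\<close> attached to the highest weight
  vector \<open>v\<close>. The first two conditions determine \<open>L\<close> and \<open>B\<close>; that the pair they determine is a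
  crystal base is the content of Kashiwara's existence theorem, so that the predicate is satisfied by exactly
  one pair.
\<close>

definition hw_crystal_base ::
    "('i::finite, 'r::finite) root_datum \<Rightarrow> ('i::finite, 'r::finite, 'm::ab_group_add) uq_module \<Rightarrow> 'm \<Rightarrow> 'm set \<Rightarrow> 'm set set \<Rightarrow> bool" where
  "hw_crystal_base D V v L B \<longleftrightarrow>
     L = regular_span V (f_monomials D V v) \<and>
     B = qcoset V L ` f_monomials D V v - {qcoset V L 0} \<and>
     crystal_base D V L B"

text \<open>The crystal graph of a crystal base: \<open>crystal_arrow D V L B i b b'\<close> is an \<open>i\<close>-arrow from \<open>b\<close> to \<open>b'\<close>.\<close>

definition crystal_arrow ::
    "('i::finite, 'r::finite) root_datum \<Rightarrow> ('i::finite, 'r::finite, 'm::ab_group_add) uq_module \<Rightarrow> 'm set \<Rightarrow> 'm set set \<Rightarrow>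
     'i \<Rightarrow> 'm set \<Rightarrow> 'm set \<Rightarrow> bool" where
  "crystal_arrow D V L B i b b' \<longleftrightarrow> b \<in> B \<and> b' \<in> B \<and> b' = induced V L (kashiwara_f D V i) b"


section \<open>Strings, Weyl group action and depth in a crystal graph\<close>

definition eps :: "('i \<Rightarrow> 'b \<Rightarrow> 'b \<Rightarrow> bool) \<Rightarrow> 'i \<Rightarrow> 'b \<Rightarrow> nat" where
  "eps arr i b = (GREATEST n. \<exists>b'. (arr i ^^ n) b' b)"

definition phi :: "('i \<Rightarrow> 'b \<Rightarrow> 'b \<Rightarrow> bool) \<Rightarrow> 'i \<Rightarrow> 'b \<Rightarrow> nat" where
  "phi arr i b = (GREATEST n. \<exists>b'. (arr i ^^ n) b b')"

text \<open>
  The mirror image of \<open>b\<close> in its \<open>i\<close>-string: \<open>b\<close> is at distance \<open>eps\<close> from the start \<open>b\<^sub>0\<close> of the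
  string and \<open>phi\<close> from its end, so its image is at distance \<open>phi\<close> from \<open>b\<^sub>0\<close>.
\<close>

definition string_mirror :: "('i \<Rightarrow> 'b \<Rightarrow> 'b \<Rightarrow> bool) \<Rightarrow> 'i \<Rightarrow> 'b \<Rightarrow> 'b" where
  "string_mirror arr i b =
     (THE b'. \<exists>b\<^sub>0. (arr i ^^ eps arr i b) b\<^sub>0 b \<and> (arr i ^^ phi arr i b) b\<^sub>0 b')"

text \<open>
  \<open>weyl_acts D arr w b b'\<close> means \<open>b' = w(b)\<close>. It is stated as a relation, \<open>b'\<close> being obtained
  from \<open>b\<close> through some expression of \<open>w\<close> as a product of simple reflections, so that
  independence of the expression (Kashiwara's theorem) need not be known beforehand.
\<close>

inductive weyl_acts ::
    "('i::finite, 'r::finite) root_datum \<Rightarrow> ('i \<Rightarrow> 'b \<Rightarrow> 'b \<Rightarrow> bool) \<Rightarrow> (complex^'r \<Rightarrow> complex^'r) \<Rightarrow> 'b \<Rightarrow> 'b \<Rightarrow> bool"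
  for D arr where
  "weyl_acts D arr id b b"
| "weyl_acts D arr w b b' \<Longrightarrow> weyl_acts D arr (simple_reflection D i \<circ> w) b (string_mirror arr i b')"

definition weyl_orbit ::
    "('i::finite, 'r::finite) root_datum \<Rightarrow> ('i \<Rightarrow> 'b \<Rightarrow> 'b \<Rightarrow> bool) \<Rightarrow> 'b \<Rightarrow> 'b set" where
  "weyl_orbit D arr b = {b'. \<exists>w\<in>weyl_group D. weyl_acts D arr w b b'}"

text \<open>
  The number of arrows in any directed path from \<open>b\<^sub>0\<close> to \<open>b\<close>; the definite description is
  meaningful only if a path exists and all such paths have the same length.
\<close>

definition depth :: "('i \<Rightarrow> 'b \<Rightarrow> 'b \<Rightarrow> bool) \<Rightarrow> 'b \<Rightarrow> 'b \<Rightarrow> nat" where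
  "depth arr b\<^sub>0 b = (THE n. ((\<lambda>x y. \<exists>i. arr i x y) ^^ n) b\<^sub>0 b)"

end

theory Submission
  imports Defs
begin

text \<open>
  Fix \<open>i\<close>. Quantum \<open>sl\<^sub>2\<close>-theory decomposes every vector uniquely into vectors \<open>F\<^sub>i\<^bsup>(n)\<^esup> u\<close> with
  \<open>E\<^sub>i u = 0\<close> and \<open>n \<le> \<langle>wt u, \<alpha>\<^sub>i\<^sup>\<or>\<rangle>\<close>, so the Kashiwara operators exist and shift weights by
  \<open>\<plusminus> \<alpha>\<^sub>i\<close>. If \<open>e\<^sub>i\<close> kills the class of a weight vector \<open>u\<close>, then \<open>u - f\<^sub>i e\<^sub>i u\<close> represents the same
  class and is annihilated by \<open>E\<^sub>i\<close>; hence each \<open>i\<close>-string of the crystal consists of the classes of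
  \<open>F\<^sub>i\<^bsup>(k)\<^esup> u\<^sub>0\<close> for \<open>0 \<le> k \<le> m = \<langle>wt u\<^sub>0, \<alpha>\<^sub>i\<^sup>\<or>\<rangle>\<close> with \<open>E\<^sub>i u\<^sub>0 = 0\<close>, and its reflection acts on weights as
  \<open>s\<^sub>i\<close>. So \<open>w(b\<^sub>\<Lambda>)\<close> has weight \<open>w \<Lambda>\<close>. Each arrow lowers the pairing of the weight with \<open>\<rho>\<close> by one, so
  every path from \<open>b\<^sub>\<Lambda>\<close> to \<open>w(b\<^sub>\<Lambda>)\<close> has length \<open>\<langle>\<Lambda> - w \<Lambda>, \<rho>\<rangle>\<close>.
\<close>


section \<open>Quantum integers\<close>

lemma qvar_power: "qvar ^ k = Fract (monom 1 k) 1"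
proof (induction k)
  case (Suc k)
  have "[:0, 1:] * monom 1 k = (monom 1 (Suc k) :: rat poly)"
    by (simp add: monom_Suc)
  with Suc show ?case by (simp add: qvar_def)
qed (simp add: One_fract_def)

lemma qi_ne_0: "qi D i \<noteq> 0"
  by (simp add: qi_def qvar_power Zero_fract_def eq_fract)

text \<open>A positive power of q is a monomial of positive degree; comparing degrees separates it
  from 1.\<close>

lemma qi_power_eq_1_iff:
  assumes "symm D i > 0"
  shows "qi D i ^ k = 1 \<longleftrightarrow> k = 0"
proof
  assume "qi D i ^ k = 1"
  then have "qvar ^ (symm D i * k) = 1" by (simp add: qi_def power_mult)
  then have "monom 1 (symm D i * k) = (1 :: rat poly)"
    by (simp add: qvar_power One_fract_def eq_fract)
  then have "degree (monom (1 :: rat) (symm D i * k)) = degree (1 :: rat poly)" by simp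
  then show "k = 0" using assms by (simp add: degree_monom_eq)
qed simp

lemma qint_0 [simp]: "qint D i 0 = 0"
  by (simp add: qint_def)

text \<open>Otherwise the power of \<open>qi D i\<close> with exponent 2m would be 1, although
  \<open>qi D i\<close> is not a root of unity. The case m = 1 covers the denominator of quantum
  integers.\<close>

lemma qi_powi_diff_ne_0:
  assumes "symm D i > 0" and "m \<noteq> 0"
  shows "qi D i powi m - qi D i powi (- m) \<noteq> 0"
proof
  assume "qi D i powi m - qi D i powi (- m) = 0"
  then have "qi D i powi m = inverse (qi D i powi m)"
    by (simp add: power_int_minus)
  moreover have "qi D i powi m \<noteq> 0" by (simp add: qi_ne_0)
  ultimately have "qi D i powi m * qi D i powi m = 1"
    by (metis right_inverse)
  then have *: "qi D i powi (2 * m) = 1"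
    by (metis mult_2 power_int_add qi_ne_0)
  have "qi D i ^ nat \<bar>2 * m\<bar> = 1"
  proof (cases "m \<ge> 0")
    case True
    with * show ?thesis by (simp add: power_int_def)
  next
    case False
    with * show ?thesis by (simp add: power_int_def power_inverse)
  qed
  then show False using assms by (simp add: qi_power_eq_1_iff)
qed

lemma qint_eq_0_iff:
  assumes "symm D i > 0"
  shows "qint D i m = 0 \<longleftrightarrow> m = 0"
  using qi_powi_diff_ne_0[OF assms, of m] qi_powi_diff_ne_0[OF assms, of 1]
  by (auto simp: qint_def)

text \<open>This is the arithmetic behind the induction step of \<open>E_F_pow\<close>: adding the
  commutator term [m - 2k] advances the coefficient [k][m - k + 1] by one step.\<close>

lemma qint_identity:
  assumes "symm D i > 0"
  shows "qint D i k * qint D i (m - k + 1) + qint D i (m - 2 * k) = qint D i (k + 1) * qint D i (m - k)"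
proof -
  \<comment> \<open>In terms of q, a and c every power involved is a Laurent monomial, so the claim
    becomes an identity of rational expressions.\<close>
  define q a c where "q = qi D i" and "a = q powi k" and "c = q powi m"
  have nz: "q \<noteq> 0" "a \<noteq> 0" "c \<noteq> 0"
    by (simp_all add: q_def a_def c_def qi_ne_0)
  have d: "q - inverse q \<noteq> 0"
    using qi_powi_diff_ne_0[OF assms, of 1] by (simp add: q_def)
  have pw: "q powi (m - k + 1) = c * q / a" "q powi (- (m - k + 1)) = a / (c * q)"
    "q powi (m - 2 * k) = c / (a * a)" "q powi (- (m - 2 * k)) = a * a / c"
    "q powi (k + 1) = a * q" "q powi (- (k + 1)) = 1 / (a * q)"
    "q powi (m - k) = c / a" "q powi (- (m - k)) = a / c" "q powi (- k) = 1 / a"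
    using nz
    by (simp_all only: a_def c_def power_int_add power_int_diff power_int_minus mult_2
        power_int_1_right divide_inverse inverse_mult_distrib inverse_inverse_eq mult_1
        simp_thms refl) (simp_all add: field_simps)
  have "(a - 1 / a) * (c * q / a - a / (c * q)) + (c / (a * a) - a * a / c) * (q - inverse q)
      = (a * q - 1 / (a * q)) * (c / a - a / c)"
    using nz by (simp add: field_simps)
  moreover have "x / e * (y / e) + z / e = (x * y + z * e) / (e * e)" if "e \<noteq> 0" for x y z e :: ratfun
    using that by (simp add: field_simps)
  ultimately show ?thesis
    using d unfolding qint_def q_def[symmetric] a_def[symmetric] pw by simp
qed

text \<open>Multiples of q vanish at 0, so q is not a unit of the local ring. This is what later
  keeps L different from qL.\<close>

lemma qvar_times_regular_ne_1:
  assumes "c \<in> regular_at_0"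
  shows "qvar * c \<noteq> 1"
proof
  obtain a b where c: "c = Fract a b" and b: "poly b 0 \<noteq> 0"
    using assms by (auto simp: regular_at_0_def)
  assume "qvar * c = 1"
  moreover from b have "b \<noteq> 0" by auto
  ultimately have "[:0, 1:] * a = b"
    by (simp add: c qvar_def One_fract_def eq_fract del: mult_pCons_left)
  then show False using b by auto
qed

section \<open>Closure properties of the local ring at q = 0\<close>

lemma Fract_regular_at_0: "poly b 0 \<noteq> 0 \<Longrightarrow> Fract a b \<in> regular_at_0"
  unfolding regular_at_0_def by blast

lemma regular_at_0_add:
  assumes "x \<in> regular_at_0" and "y \<in> regular_at_0"
  shows "x + y \<in> regular_at_0"
proof -
  obtain a b c d where "x = Fract a b" "y = Fract c d" and nz: "poly b 0 \<noteq> 0" "poly d 0 \<noteq> 0"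
    using assms by (auto simp: regular_at_0_def)
  moreover from nz have "b \<noteq> 0" "d \<noteq> 0" by auto
  ultimately have "x + y = Fract (a * d + c * b) (b * d)" by simp
  then show ?thesis using nz by (simp add: Fract_regular_at_0)
qed

lemma regular_at_0_uminus:
  assumes "x \<in> regular_at_0"
  shows "- x \<in> regular_at_0"
proof -
  obtain a b where "x = Fract a b" "poly b 0 \<noteq> 0"
    using assms by (auto simp: regular_at_0_def)
  then show ?thesis by (simp add: Fract_regular_at_0)
qed

lemma zero_regular_at_0: "0 \<in> regular_at_0"
  unfolding Zero_fract_def by (rule Fract_regular_at_0) simp

lemma one_regular_at_0: "1 \<in> regular_at_0"
  unfolding One_fract_def by (rule Fract_regular_at_0) simp

section \<open>Linearity of the pairing in the weight\<close>

lemma pairing_add: "pairing (x + y) h = pairing x h + pairing y h"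
  by (simp add: pairing_def distrib_right sum.distrib)

lemma pairing_diff: "pairing (x - y) h = pairing x h - pairing y h"
  by (simp add: pairing_def left_diff_distrib sum_subtractf)

lemma pairing_scale: "pairing (c *s x) h = c * pairing x h"
  by (simp add: pairing_def sum_distrib_left mult.assoc)


section \<open>Reflections of finite strings\<close>

text \<open>The hypotheses list all arrows at vertices of the chain, so iterated arrows are forced
  in both directions. Hence \<open>eps\<close> is k, \<open>phi\<close> is m - k, the start is
  \<open>\<beta> 0\<close>, and walking \<open>phi\<close> steps from it ends at m - k.\<close>

lemma string_mirror_chain:
  assumes succ: "\<And>k x. k \<le> m \<Longrightarrow> arr i (\<beta> k) x \<longleftrightarrow> k < m \<and> x = \<beta> (Suc k)"
    and pred: "\<And>k x. k \<le> m \<Longrightarrow> arr i x (\<beta> k) \<longleftrightarrow> 0 < k \<and> x = \<beta> (k - 1)"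
    and k: "k \<le> m"
  shows "string_mirror arr i (\<beta> k) = \<beta> (m - k)"
proof -
  have fwd: "(arr i ^^ n) (\<beta> j) x \<longleftrightarrow> j + n \<le> m \<and> x = \<beta> (j + n)" if "j \<le> m" for n j x
  proof (induction n arbitrary: x)
    case 0
    show ?case using that by auto
  next
    case (Suc n)
    have "(arr i ^^ Suc n) (\<beta> j) x \<longleftrightarrow> j + n \<le> m \<and> arr i (\<beta> (j + n)) x"
      by (auto simp: Suc)
    then show ?case using succ[of "j + n" x] by auto
  qed
  have bwd: "(arr i ^^ n) x (\<beta> k) \<longleftrightarrow> n \<le> k \<and> x = \<beta> (k - n)" for n x
  proof (induction n arbitrary: x)
    case (Suc n)
    have "(arr i ^^ Suc n) x (\<beta> k) \<longleftrightarrow> n \<le> k \<and> arr i x (\<beta> (k - n))"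
      unfolding relpowp_Suc_left by (auto simp: Suc)
    then show ?case using pred[of "k - n" x] k by auto
  qed auto
  have "eps arr i (\<beta> k) = k"
    unfolding eps_def by (rule Greatest_equality) (auto simp: bwd)
  moreover have "phi arr i (\<beta> k) = m - k"
    unfolding phi_def by (rule Greatest_equality) (use k in \<open>auto simp: fwd\<close>)
  ultimately show ?thesis
    unfolding string_mirror_def by (intro the_equality) (auto simp: bwd fwd)
qed


section \<open>The quantum \<open>sl\<^sub>2\<close>-strings of an integrable module\<close>

locale integrable_uq_module =
  fixes D :: "('i::finite, 'r::finite) root_datum"
    and V :: "('i, 'r, 'm::ab_group_add) uq_module"
  assumes datum: "kac_moody_datum D"
    and integrable: "integrable_module D V"
begin

sublocale vector_space "scl V"
  using integrable by (simp add: integrable_module_def)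

abbreviation height :: "'i \<Rightarrow> complex^'r \<Rightarrow> complex" where
  "height i \<mu> \<equiv> pairing \<mu> (simple_coroot D i)"

abbreviation root_shift :: "complex^'r \<Rightarrow> 'i \<Rightarrow> nat \<Rightarrow> complex^'r" where
  "root_shift \<mu> i n \<equiv> \<mu> - of_nat n *s simple_root D i"

abbreviation fpow :: "'i \<Rightarrow> nat \<Rightarrow> 'm \<Rightarrow> 'm" where
  "fpow \<equiv> divpow D V (opF V)"

lemma symm_pos: "symm D i > 0"
  using datum by (simp add: kac_moody_datum_def)

lemma height_simple_root: "height i (simple_root D i) = 2"
  using datum by (simp add: kac_moody_datum_def gcm_def)

lemma linear_E: "Vector_Spaces.linear (scl V) (scl V) (opE V i)"
  and linear_F: "Vector_Spaces.linear (scl V) (scl V) (opF V i)"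
  using integrable by (simp_all add: integrable_module_def)

lemma linear_funpow:
  assumes "Vector_Spaces.linear (scl V) (scl V) g"
  shows "Vector_Spaces.linear (scl V) (scl V) (\<lambda>u. (g ^^ n) u)"
proof -
  interpret g: Vector_Spaces.linear "scl V" "scl V" g by fact
  show ?thesis by unfold_locales (induction n; simp add: g.add g.scale)+
qed

interpretation E: Vector_Spaces.linear "scl V" "scl V" "opE V i" for i by (rule linear_E)
interpretation F: Vector_Spaces.linear "scl V" "scl V" "opF V i" for i by (rule linear_F)

lemma wsp_E: "u \<in> wsp V \<mu> \<Longrightarrow> opE V i u \<in> wsp V (\<mu> + simple_root D i)"
  and wsp_F: "u \<in> wsp V \<mu> \<Longrightarrow> opF V i u \<in> wsp V (\<mu> - simple_root D i)"
  using integrable unfolding integrable_module_def by blast+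

lemma subspace_wsp: "subspace (wsp V \<mu>)"
  using integrable by (simp add: integrable_module_def)

lemma E_nilpotent: "\<exists>n. (opE V i ^^ n) u = 0"
  and F_nilpotent: "\<exists>n. (opF V i ^^ n) u = 0"
  using integrable by (simp_all add: integrable_module_def)

lemma wsp_integral:
  assumes "u \<in> wsp V \<mu>" and "u \<noteq> 0"
  obtains m where "height i \<mu> = of_int m"
proof -
  have "\<mu> \<in> weight_lattice D"
    using assms integrable by (auto simp: integrable_module_def)
  then show ?thesis using that by (auto simp: weight_lattice_def Ints_def)
qed

lemma E_F_commute:
  assumes "u \<in> wsp V \<mu>" and "height i \<mu> = of_int m"
  shows "opE V i (opF V i u) = opF V i (opE V i u) + scl V (qint D i m) u"
proof -
  have "\<forall>i j \<mu> m. \<forall>u\<in>wsp V \<mu>. pairing \<mu> (simple_coroot D i) = of_int m \<longrightarrow>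
      opE V i (opF V j u) - opF V j (opE V i u) = (if i = j then scl V (qint D i m) u else 0)"
    using integrable by (simp add: integrable_module_def)
  with assms have "opE V i (opF V i u) - opF V i (opE V i u) = scl V (qint D i m) u"
    by auto
  then show ?thesis by (simp add: algebra_simps)
qed

lemma weight_decomp_unique: "\<exists>!c. weight_decomp V u c"
  using integrable by (simp add: integrable_module_def)

text \<open>Extended by zero, the family is a weight decomposition of 0, and so is the zero family;
  decompositions are unique.\<close>

lemma weight_components_zero:
  assumes "finite M" and "\<And>\<mu>. \<mu> \<in> M \<Longrightarrow> x \<mu> \<in> wsp V \<mu>" and "(\<Sum>\<mu>\<in>M. x \<mu>) = 0"
    and "\<mu> \<in> M"
  shows "x \<mu> = 0"
proof -
  define c where "c \<nu> = (if \<nu> \<in> M then x \<nu> else 0)" for \<nu>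
  have supp: "{\<nu>. c \<nu> \<noteq> 0} \<subseteq> M" by (auto simp: c_def)
  have "(\<Sum>\<nu> | c \<nu> \<noteq> 0. c \<nu>) = (\<Sum>\<nu>\<in>M. c \<nu>)"
    by (rule sum.mono_neutral_left) (use supp assms in auto)
  also have "\<dots> = 0" using assms(3) by (simp add: c_def)
  finally have "weight_decomp V 0 c"
    using assms(1,2) supp subspace_0[OF subspace_wsp]
    by (auto simp: weight_decomp_def c_def finite_subset)
  moreover have "weight_decomp V 0 (\<lambda>_. 0)"
    using subspace_0[OF subspace_wsp] by (auto simp: weight_decomp_def)
  ultimately have "c = (\<lambda>_. 0)"
    using weight_decomp_unique by blast
  then have "c \<mu> = 0" by simp
  then show ?thesis using assms(4) by (simp add: c_def)
qed

section \<open>Weights and the action of \<open>opE\<close> along powers of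
  \<open>opF\<close>\<close>

lemma height_shift: "height i \<mu> = of_int m \<Longrightarrow> height i (root_shift \<mu> i n) = of_int (m - 2 * int n)"
  unfolding pairing_diff pairing_scale height_simple_root by simp

lemma root_shift_Suc: "root_shift \<mu> i n - simple_root D i = root_shift \<mu> i (Suc n)"
  by (simp add: vec_eq_iff algebra_simps)

lemma wsp_F_pow:
  assumes "u \<in> wsp V \<mu>"
  shows "(opF V i ^^ n) u \<in> wsp V (root_shift \<mu> i n)"
proof (induction n)
  case (Suc n)
  from wsp_F[OF this, of i] show ?case by (simp only: root_shift_Suc funpow.simps o_apply)
qed (use assms in simp)

lemma wsp_fpow: "u \<in> wsp V \<mu> \<Longrightarrow> fpow i n u \<in> wsp V (root_shift \<mu> i n)"
  unfolding divpow_def by (intro subspace_scale subspace_wsp wsp_F_pow)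

text \<open>Each commutation of \<open>opE\<close> past \<open>opF\<close> contributes one quantum
  integer, and \<open>qint_identity\<close> sums them. Requiring only FEu = 0 rather than Eu = 0
  allows the use on vectors not yet known to be killed by \<open>opE\<close>.\<close>

lemma E_F_pow:
  assumes u: "u \<in> wsp V \<mu>" and h: "height i \<mu> = of_int m" and FE: "opF V i (opE V i u) = 0"
  shows "opE V i ((opF V i ^^ Suc n) u) =
    scl V (qint D i (int n + 1) * qint D i (m - int n)) ((opF V i ^^ n) u)"
proof (induction n)
  case 0
  show ?case
    \<comment> \<open>At k = 0 the identity reads [m] = [1][m].\<close>
    using E_F_commute[OF u h] FE qint_identity[OF symm_pos, where k = 0 and m = m] by simp
next
  case (Suc n)
  let ?x = "(opF V i ^^ Suc n) u"
  have "opE V i ((opF V i ^^ Suc (Suc n)) u) = opF V i (opE V i ?x) + scl V (qint D i (m - 2 * int (Suc n))) ?x"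
    using E_F_commute[OF wsp_F_pow[OF u] height_shift[OF h], of "Suc n"] by simp
  also have "opF V i (opE V i ?x) = scl V (qint D i (int n + 1) * qint D i (m - int n)) ?x"
    unfolding Suc by (simp add: F.scale)
  finally have "opE V i ((opF V i ^^ Suc (Suc n)) u) =
      scl V (qint D i (int n + 1) * qint D i (m - int n) + qint D i (m - 2 * int (Suc n))) ?x"
    by (simp only: scale_left_distrib)
  also have "qint D i (int n + 1) * qint D i (m - int n) + qint D i (m - 2 * int (Suc n)) =
      qint D i (int (Suc n) + 1) * qint D i (m - int (Suc n))"
    using qint_identity[OF symm_pos, of i "int (Suc n)" m] by (simp add: algebra_simps)
  finally show ?case .
qed

text \<open>For m < 0 no coefficient [n + 1][m - n] vanishes, so applying \<open>opE\<close>
  descends from the vanishing of a power of \<open>opF\<close> on u, given by local nilpotency, to u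
  = 0.\<close>

lemma negative_height_zero:
  assumes u: "u \<in> wsp V \<mu>" and h: "height i \<mu> = of_int m" and FE: "opF V i (opE V i u) = 0"
    and m: "m < 0"
  shows "u = 0"
proof -
  obtain N where N: "(opF V i ^^ N) u = 0" using F_nilpotent by blast
  have "(opF V i ^^ n) u = 0" if "(opF V i ^^ Suc n) u = 0" for n
    using E_F_pow[OF u h FE, of n] that m by (simp add: E.zero qint_eq_0_iff[OF symm_pos])
  then have "(opF V i ^^ N) u = 0 \<Longrightarrow> u = 0"
    by (induction N) auto
  with N show ?thesis by simp
qed

text \<open>At the first power beyond m the coefficient of \<open>E_F_pow\<close> contains [0], so
  this vector is killed by \<open>opE\<close>; its height is negative, so it is zero.\<close>

lemma F_pow_vanish:
  assumes u: "u \<in> wsp V \<mu>" and h: "height i \<mu> = of_int m" and E: "opE V i u = 0"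
    and n: "m < int n"
  shows "(opF V i ^^ n) u = 0"
proof (cases "m < 0")
  case True
  then have "u = 0" using negative_height_zero[OF u h] E by (simp add: F.zero)
  then show ?thesis by (induction n) (simp_all add: F.zero)
next
  case False
  define k where "k = nat m"
  have k: "m = int k" using False by (simp add: k_def)
  have FE: "opF V i (opE V i u) = 0" by (simp add: E F.zero)
  have "opE V i ((opF V i ^^ Suc k) u) = 0"
    unfolding E_F_pow[OF u h FE] by (simp add: k)
  then have "opF V i (opE V i ((opF V i ^^ Suc k) u)) = 0"
    by (simp only: F.zero)
  \<comment> \<open>The height here is k - 2(k + 1) = -k - 2.\<close>
  from negative_height_zero[OF wsp_F_pow[OF u] height_shift[OF h] this]
  have *: "(opF V i ^^ Suc k) u = 0" by (simp add: k)
  obtain j where "n = j + Suc k" using n k by (metis add.commute less_iff_Suc_add add_Suc_right of_nat_less_iff)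
  then have "(opF V i ^^ n) u = (opF V i ^^ j) 0"
    by (simp only: funpow_add o_apply *)
  also have "\<dots> = 0" by (induction j) (simp_all add: F.zero)
  finally show ?thesis .
qed

section \<open>Divided powers and returning to the head of a string\<close>

lemma linear_fpow: "Vector_Spaces.linear (scl V) (scl V) (fpow i n)"
proof -
  interpret P: Vector_Spaces.linear "scl V" "scl V" "\<lambda>u. (opF V i ^^ n) u"
    by (intro linear_funpow linear_F)
  show ?thesis
    by unfold_locales (simp_all add: divpow_def P.add P.scale scale_right_distrib mult.commute)
qed

interpretation fpow: Vector_Spaces.linear "scl V" "scl V" "fpow i n" for i n by (rule linear_fpow)

lemma fpow_0 [simp]: "fpow i 0 u = u"
  by (simp add: divpow_def qfact_def)

lemma qfact_Suc: "qfact D i (Suc n) = qfact D i n * qint D i (int n + 1)"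
  by (simp add: qfact_def add.commute)

lemma qfact_ne_0: "qfact D i n \<noteq> 0"
  by (simp add: qfact_def qint_eq_0_iff[OF symm_pos])

lemma fpow_vanish:
  assumes "u \<in> wsp V \<mu>" and "height i \<mu> = of_int m" and "opE V i u = 0" and "m < int n"
  shows "fpow i n u = 0"
  using F_pow_vanish[OF assms] by (simp add: divpow_def)

lemma F_fpow: "opF V i (fpow i n u) = scl V (qint D i (int n + 1)) (fpow i (Suc n) u)"
proof -
  have "qint D i (int n + 1) \<noteq> 0" by (simp add: qint_eq_0_iff[OF symm_pos])
  then show ?thesis
    using qfact_ne_0 by (simp add: divpow_def F.scale qfact_Suc field_simps)
qed

lemma E_fpow_Suc:
  assumes u: "u \<in> wsp V \<mu>" and h: "height i \<mu> = of_int m" and E: "opE V i u = 0"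
  shows "opE V i (fpow i (Suc n) u) = scl V (qint D i (m - int n)) (fpow i n u)"
proof -
  have FE: "opF V i (opE V i u) = 0" by (simp add: E F.zero)
  have "qint D i (int n + 1) \<noteq> 0" by (simp add: qint_eq_0_iff[OF symm_pos])
  then show ?thesis
    using qfact_ne_0
    unfolding divpow_def E.scale E_F_pow[OF u h FE] by (simp add: qfact_Suc field_simps)
qed

text \<open>Climbing n steps multiplies by [m - j] for each j < n. The product is nonzero when n is
  at most m, so the head of a string can be recovered.\<close>

lemma E_pow_fpow:
  assumes u: "u \<in> wsp V \<mu>" and h: "height i \<mu> = of_int m" and E: "opE V i u = 0"
  shows "(opE V i ^^ n) (fpow i n u) = scl V (\<Prod>j<n. qint D i (m - int j)) u"
proof (induction n)
  case (Suc n)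
  have "(opE V i ^^ n) (scl V a x) = scl V a ((opE V i ^^ n) x)" for a x
    by (induction n) (simp_all add: E.scale)
  then show ?case
    using Suc by (simp add: funpow_Suc_right E_fpow_Suc[OF assms] mult.commute del: funpow.simps)
qed simp

lemma E_pow_fpow_zero:
  assumes u: "u \<in> wsp V \<mu>" and h: "height i \<mu> = of_int m" and E: "opE V i u = 0" and "n < k"
  shows "(opE V i ^^ k) (fpow i n u) = 0"
proof -
  obtain j where k: "k = Suc j + n" using \<open>n < k\<close> by (metis add.commute add_Suc_right less_iff_Suc_add)
  have "(opE V i ^^ k) (fpow i n u) = (opE V i ^^ Suc j) (scl V (\<Prod>j<n. qint D i (m - int j)) u)"
    by (simp only: k funpow_add o_apply E_pow_fpow[OF u h E])
  also have "\<dots> = (opE V i ^^ j) 0"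
    by (simp add: funpow_Suc_right E.scale E del: funpow.simps)
  also have "\<dots> = 0" by (induction j) (simp_all add: E.zero)
  finally show ?thesis .
qed

text \<open>The bound on n is imposed on nonzero vectors only. Thus 0 qualifies for every weight and
  every n, and for fixed weight and n these vectors form a subspace.\<close>

definition string_vector :: "'i \<Rightarrow> complex^'r \<Rightarrow> nat \<Rightarrow> 'm \<Rightarrow> bool" where
  "string_vector i \<mu> n u \<longleftrightarrow> u \<in> wsp V \<mu> \<and> opE V i u = 0 \<and>
     (u \<noteq> 0 \<longrightarrow> (\<exists>m. height i \<mu> = of_int m \<and> int n \<le> m))"

lemma string_vector_0: "string_vector i \<mu> n 0"
  by (simp add: string_vector_def subspace_0 subspace_wsp E.zero)

lemma string_vector_add: "string_vector i \<mu> n u \<Longrightarrow> string_vector i \<mu> n u' \<Longrightarrow> string_vector i \<mu> n (u + u')"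
  by (cases "u = 0"; cases "u' = 0") (auto simp: string_vector_def subspace_add subspace_wsp E.add)

lemma string_vector_scale: "string_vector i \<mu> n u \<Longrightarrow> string_vector i \<mu> n (scl V a u)"
  by (auto simp: string_vector_def subspace_scale subspace_wsp E.scale)

text \<open>
  Divided powers of the components of \<open>E\<^sub>i u\<close>, suitably rescaled, remove \<open>E\<^sub>i u\<close> up to a single term
  at the bottom of its string; that term would force a vector of negative height annihilated by
  \<open>F\<^sub>i E\<^sub>i\<close>, and there is none.
\<close>

lemma weight_vector_strings:
  assumes "u \<in> wsp V \<mu>" and "(opE V i ^^ N) u = 0"
  shows "\<exists>c. (\<forall>n. string_vector i (\<mu> + of_nat n *s simple_root D i) n (c n)) \<and>
    u = (\<Sum>n<N. fpow i n (c n))"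
  using assms
proof (induction N arbitrary: u \<mu>)
  case 0
  then show ?case by (auto intro!: exI[of _ "\<lambda>_. 0"] simp: string_vector_0)
next
  case (Suc N)
  let ?\<alpha> = "simple_root D i"
  show ?case
  proof (cases "u = 0")
    case True
    then show ?thesis by (auto intro!: exI[of _ "\<lambda>_. 0"] simp: string_vector_0 fpow.zero)
  next
    case False
    then obtain m where h: "height i \<mu> = of_int m" using wsp_integral Suc.prems by blast
    have "(opE V i ^^ N) (opE V i u) = 0"
      using Suc.prems by (simp add: funpow_Suc_right del: funpow.simps)
    from Suc.IH[OF wsp_E[OF Suc.prems(1)] this] obtain d where
      d: "\<And>n. string_vector i (\<mu> + ?\<alpha> + of_nat n *s ?\<alpha>) n (d n)" and
      Eu: "opE V i u = (\<Sum>n<N. fpow i n (d n))" by blast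
    have hd: "height i (\<mu> + ?\<alpha> + of_nat n *s ?\<alpha>) = of_int (m + 2 * int n + 2)" for n
      unfolding pairing_add pairing_scale height_simple_root h by simp
    have dw: "d n \<in> wsp V (\<mu> + ?\<alpha> + of_nat n *s ?\<alpha>)" and dE: "opE V i (d n) = 0" for n
      using d by (simp_all add: string_vector_def)
    have db: "int n \<le> m + 2 * int n + 2" if "d n \<noteq> 0" for n
      using d[of n] that unfolding string_vector_def hd of_int_eq_iff by auto
    \<comment> \<open>The coefficient to be cancelled is [m + n + 2]. If it is zero,
      \<open>inverse\<close> returns 0, so the corresponding term is left in place.\<close>
    define a where "a n = inverse (qint D i (m + int n + 2))" for n
    define x where "x = u - (\<Sum>n<N. fpow i (Suc n) (scl V (a n) (d n)))"
    define c where "c n = (case n of 0 \<Rightarrow> x | Suc n \<Rightarrow> scl V (a n) (d n))" for n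
    have "fpow i (Suc n) (scl V (a n) (d n)) \<in> wsp V \<mu>" for n
    proof -
      have "root_shift (\<mu> + ?\<alpha> + of_nat n *s ?\<alpha>) i (Suc n) = \<mu>"
        by (simp add: vec_eq_iff algebra_simps)
      then show ?thesis
        using wsp_fpow[OF subspace_scale[OF subspace_wsp dw[of n], of "a n"], of i "Suc n"] by simp
    qed
    then have x: "x \<in> wsp V \<mu>"
      unfolding x_def by (intro subspace_diff subspace_sum subspace_wsp Suc.prems)
    have "opE V i x = (\<Sum>n<N. fpow i n (d n) - scl V (a n) (opE V i (fpow i (Suc n) (d n))))"
      by (simp add: x_def E.diff E.sum Eu sum_subtractf fpow.scale E.scale)
    also have "\<dots> = (\<Sum>n<N. if m + int n + 2 = 0 then fpow i n (d n) else 0)"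
    proof (rule sum.cong)
      fix n
      have e: "m + 2 * int n + 2 - int n = m + int n + 2" by simp
      show "fpow i n (d n) - scl V (a n) (opE V i (fpow i (Suc n) (d n))) =
          (if m + int n + 2 = 0 then fpow i n (d n) else 0)"
        unfolding E_fpow_Suc[OF dw hd dE] a_def e by (simp add: qint_eq_0_iff[OF symm_pos])
    qed simp
    finally have Ex: "opE V i x = (\<Sum>n<N. if m + int n + 2 = 0 then fpow i n (d n) else 0)" .
    \<comment> \<open>When m + n + 2 = 0 the head \<open>d n\<close> has height exactly n, so the
      divided power n + 1 of it vanishes.\<close>
    have "opF V i (if m + int n + 2 = 0 then fpow i n (d n) else 0) = 0" for n
      using fpow_vanish[OF dw hd dE, of n "Suc n"] by (simp add: F_fpow F.zero)
    then have FEx: "opF V i (opE V i x) = 0" unfolding Ex F.sum by simp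
    have "string_vector i \<mu> 0 x"
    proof (cases "m < 0")
      case True
      then show ?thesis using negative_height_zero[OF x h FEx] by (simp add: string_vector_0)
    next
      case False
      \<comment> \<open>For nonnegative m no leftover index satisfies m + n + 2 = 0.\<close>
      then have "opE V i x = 0" unfolding Ex by (intro sum.neutral) auto
      with False show ?thesis by (simp add: string_vector_def x h)
    qed
    moreover have "string_vector i (\<mu> + of_nat (Suc n) *s ?\<alpha>) (Suc n) (scl V (a n) (d n))" for n
    proof -
      have e: "\<mu> + of_nat (Suc n) *s ?\<alpha> = \<mu> + ?\<alpha> + of_nat n *s ?\<alpha>"
        by (simp add: vec_eq_iff algebra_simps)
      \<comment> \<open>The bound for \<open>d n\<close> says m + n + 2 is nonnegative; a nonzero
        \<open>a n\<close> excludes zero, which supplies the extra unit.\<close>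
      have "int (Suc n) \<le> m + 2 * int n + 2" if "scl V (a n) (d n) \<noteq> 0"
      proof -
        have "d n \<noteq> 0" "m + int n + 2 \<noteq> 0" using that by (auto simp: a_def)
        with db[of n] show ?thesis by auto
      qed
      then show ?thesis
        unfolding string_vector_def e hd of_int_eq_iff
        using dw dE by (auto simp: subspace_scale subspace_wsp E.scale)
    qed
    ultimately have "string_vector i (\<mu> + of_nat n *s ?\<alpha>) n (c n)" for n
      by (cases n) (simp_all add: c_def)
    moreover have "u = (\<Sum>n<Suc N. fpow i n (c n))"
      unfolding sum.lessThan_Suc_shift by (simp add: c_def x_def)
    ultimately show ?thesis by blast
  qed
qed

section \<open>Decomposition of arbitrary vectors into strings\<close>

definition string_family :: "'i \<Rightarrow> ((complex^'r) \<times> nat \<Rightarrow> 'm) \<Rightarrow> bool" where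
  "string_family i c \<longleftrightarrow> finite {p. c p \<noteq> 0} \<and> (\<forall>\<mu> n. string_vector i \<mu> n (c (\<mu>, n)))"

text \<open>An index (mu, n) records the weight of a string head and the number of steps below it.
  The operators T are left open: \<open>fpow i\<close> rebuilds the vector itself, other choices
  give the image under an operator prescribed on strings.\<close>

definition assemble :: "(nat \<Rightarrow> 'm \<Rightarrow> 'm) \<Rightarrow> ((complex^'r) \<times> nat \<Rightarrow> 'm) \<Rightarrow> 'm" where
  "assemble T c = (\<Sum>p | c p \<noteq> 0. T (snd p) (c p))"

lemma assemble_eq_sum:
  assumes "finite M" and "{p. c p \<noteq> 0} \<subseteq> M" and "\<And>n. T n 0 = 0"
  shows "assemble T c = (\<Sum>p\<in>M. T (snd p) (c p))"
  unfolding assemble_def by (rule sum.mono_neutral_left) (use assms in auto)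

lemma string_family_add:
  assumes "string_family i c" and "string_family i d"
  shows "string_family i (\<lambda>p. c p + d p)"
proof -
  have "{p. c p + d p \<noteq> 0} \<subseteq> {p. c p \<noteq> 0} \<union> {p. d p \<noteq> 0}" by auto
  then show ?thesis
    using assms finite_subset by (auto simp: string_family_def string_vector_add)
qed

lemma string_family_scale:
  assumes "string_family i c"
  shows "string_family i (\<lambda>p. scl V a (c p))"
proof -
  have "{p. scl V a (c p) \<noteq> 0} \<subseteq> {p. c p \<noteq> 0}" by auto
  then show ?thesis
    using assms finite_subset by (auto simp: string_family_def string_vector_scale)
qed

lemma string_family_single:
  assumes "string_vector i \<mu> n u"
  shows "string_family i (\<lambda>p. if p = (\<mu>, n) then u else 0)"
  using assms by (auto simp: string_family_def string_vector_0)

lemma assemble_single: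
  assumes "T n 0 = 0"
  shows "assemble T (\<lambda>p. if p = (\<mu>, n) then u else 0) = T n u"
proof (cases "u = 0")
  case False
  then have "{p. (if p = (\<mu>, n) then u else 0) \<noteq> 0} = {(\<mu>, n)}" by auto
  then show ?thesis by (simp add: assemble_def)
qed (simp add: assemble_def assms)

lemma assemble_add:
  assumes "\<And>n. Vector_Spaces.linear (scl V) (scl V) (T n)"
    and "string_family i c" and "string_family i d"
  shows "assemble T (\<lambda>p. c p + d p) = assemble T c + assemble T d"
proof -
  interpret T: Vector_Spaces.linear "scl V" "scl V" "T n" for n by fact
  let ?M = "{p. c p \<noteq> 0} \<union> {p. d p \<noteq> 0}"
  have fin: "finite ?M" using assms by (simp add: string_family_def)
  note * = assemble_eq_sum[where T = T, OF fin]
  have "assemble T (\<lambda>p. c p + d p) = (\<Sum>p\<in>?M. T (snd p) (c p + d p))"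
    by (rule *) (auto simp: T.zero)
  moreover have "assemble T c = (\<Sum>p\<in>?M. T (snd p) (c p))"
    by (rule *) (auto simp: T.zero)
  moreover have "assemble T d = (\<Sum>p\<in>?M. T (snd p) (d p))"
    by (rule *) (auto simp: T.zero)
  ultimately show ?thesis by (simp add: T.add sum.distrib)
qed

lemma assemble_scale:
  assumes "\<And>n. Vector_Spaces.linear (scl V) (scl V) (T n)" and "string_family i c"
  shows "assemble T (\<lambda>p. scl V a (c p)) = scl V a (assemble T c)"
proof -
  interpret T: Vector_Spaces.linear "scl V" "scl V" "T n" for n by fact
  have fin: "finite {p. c p \<noteq> 0}" using assms by (simp add: string_family_def)
  have "assemble T (\<lambda>p. scl V a (c p)) = (\<Sum>p | c p \<noteq> 0. T (snd p) (scl V a (c p)))"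
    by (rule assemble_eq_sum[OF fin]) (auto simp: T.zero)
  then show ?thesis by (simp add: assemble_def T.scale scale_sum_right)
qed

text \<open>The vectors that can be assembled form a subspace. It contains the members of strings,
  hence all weight vectors by \<open>weight_vector_strings\<close>, hence everything.\<close>

lemma string_family_exists: "\<exists>c. string_family i c \<and> assemble (fpow i) c = u"
proof -
  define S where "S = {u. \<exists>c. string_family i c \<and> assemble (fpow i) c = u}"
  have S: "subspace S"
  proof (rule subspaceI)
    have "string_family i (\<lambda>_. 0)" and "assemble (fpow i) (\<lambda>_. 0) = 0"
      by (simp_all add: string_family_def assemble_def string_vector_0)
    then show "0 \<in> S" unfolding S_def by blast
  next
    fix x y assume "x \<in> S" "y \<in> S"
    then obtain c d where c: "string_family i c" "assemble (fpow i) c = x"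
      and d: "string_family i d" "assemble (fpow i) d = y" unfolding S_def by blast
    have "assemble (fpow i) (\<lambda>p. c p + d p) = x + y"
      using assemble_add[of "fpow i", OF linear_fpow c(1) d(1)] c d by simp
    with string_family_add[OF c(1) d(1)] show "x + y \<in> S" unfolding S_def by blast
  next
    fix a x assume "x \<in> S"
    then obtain c where c: "string_family i c" "assemble (fpow i) c = x" unfolding S_def by blast
    have "assemble (fpow i) (\<lambda>p. scl V a (c p)) = scl V a x"
      using assemble_scale[of "fpow i", OF linear_fpow c(1)] c by simp
    with string_family_scale[OF c(1)] show "scl V a x \<in> S" unfolding S_def by blast
  qed
  have string: "fpow i n x \<in> S" if "string_vector i \<mu> n x" for \<mu> n x
  proof -
    have "assemble (fpow i) (\<lambda>p. if p = (\<mu>, n) then x else 0) = fpow i n x"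
      by (rule assemble_single) (rule fpow.zero)
    with string_family_single[OF that] show ?thesis unfolding S_def by blast
  qed
  have weight: "x \<in> S" if "x \<in> wsp V \<mu>" for x \<mu>
  proof -
    obtain N where N: "(opE V i ^^ N) x = 0" using E_nilpotent by blast
    from weight_vector_strings[OF that this] obtain c where
      "\<And>n. string_vector i (\<mu> + of_nat n *s simple_root D i) n (c n)"
      and x: "x = (\<Sum>n<N. fpow i n (c n))" by blast
    then show ?thesis unfolding x by (intro subspace_sum S string)
  qed
  obtain c where "weight_decomp V u c" using weight_decomp_unique by blast
  then have c: "\<And>\<mu>. c \<mu> \<in> wsp V \<mu>" and u: "u = (\<Sum>\<mu> | c \<mu> \<noteq> 0. c \<mu>)"
    by (simp_all add: weight_decomp_def)
  have "u \<in> S" unfolding u by (intro subspace_sum S weight[OF c])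
  then show ?thesis by (simp add: S_def)
qed

text \<open>A power of \<open>E\<^sub>i\<close> isolates the components lying highest in their strings; weights separate these.\<close>

lemma string_family_zero:
  assumes c: "string_family i c" and 0: "assemble (fpow i) c = 0"
  shows "c p = 0"
proof (rule ccontr)
  assume "c p \<noteq> 0"
  define M where "M = {p. c p \<noteq> 0}"
  have fin: "finite M" and ne: "M \<noteq> {}"
    using c \<open>c p \<noteq> 0\<close> unfolding M_def string_family_def by blast+
  \<comment> \<open>N is the lowest string position that occurs; the N-th power of
    \<open>opE\<close> kills every component at a position n < N.\<close>
  define N where "N = Max (snd ` M)"
  have N: "snd p \<le> N" if "p \<in> M" for p
    unfolding N_def using that fin by (intro Max_ge) auto
  have "N \<in> snd ` M" unfolding N_def using fin ne by (intro Max_in) auto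
  then obtain \<mu> where \<mu>: "(\<mu>, N) \<in> M" by auto
  have str: "string_vector i \<nu> n (c (\<nu>, n))" for \<nu> n
    using c by (simp add: string_family_def)
  define m where "m \<nu> = (THE m. height i \<nu> = of_int m)" for \<nu>
  have m: "height i \<nu> = of_int (m \<nu>) \<and> int n \<le> m \<nu>" if "(\<nu>, n) \<in> M" for \<nu> n
  proof -
    have "c (\<nu>, n) \<noteq> 0" using that by (simp add: M_def)
    then obtain l where l: "height i \<nu> = of_int l" "int n \<le> l"
      using str[of \<nu> n] unfolding string_vector_def by blast
    then have "m \<nu> = l" unfolding m_def by (intro the_equality) simp_all
    with l show ?thesis by simp
  qed
  have cw: "c (\<nu>, n) \<in> wsp V \<nu>" and cE: "opE V i (c (\<nu>, n)) = 0" for \<nu> n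
    using str[of \<nu> n] by (simp_all add: string_vector_def)
  interpret EN: Vector_Spaces.linear "scl V" "scl V" "\<lambda>u. (opE V i ^^ N) u"
    by (intro linear_funpow linear_E)
  define k where "k \<nu> = (\<Prod>j<N. qint D i (m \<nu> - int j))" for \<nu>
  let ?T = "{\<nu>. (\<nu>, N) \<in> M}"
  have finT: "finite ?T"
    by (rule finite_subset[OF _ finite_imageI[OF fin, of fst]]) force
  have "0 = (opE V i ^^ N) (\<Sum>p\<in>M. fpow i (snd p) (c p))"
    using 0 by (simp add: assemble_def M_def EN.zero)
  also have "\<dots> = (\<Sum>p\<in>M. (opE V i ^^ N) (fpow i (snd p) (c p)))"
    by (rule EN.sum)
  also have "\<dots> = (\<Sum>p\<in>(\<lambda>\<nu>. (\<nu>, N)) ` ?T. (opE V i ^^ N) (fpow i (snd p) (c p)))"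
  proof (rule sum.mono_neutral_right[OF fin])
    show "\<forall>p\<in>M - (\<lambda>\<nu>. (\<nu>, N)) ` ?T. (opE V i ^^ N) (fpow i (snd p) (c p)) = 0"
    proof
      fix p assume p: "p \<in> M - (\<lambda>\<nu>. (\<nu>, N)) ` ?T"
      obtain \<nu> n where [simp]: "p = (\<nu>, n)" by fastforce
      have "n \<le> N" "n \<noteq> N" and n: "(\<nu>, n) \<in> M" using p N[of p] by auto
      then have "n < N" by simp
      then show "(opE V i ^^ N) (fpow i (snd p) (c p)) = 0"
        using E_pow_fpow_zero[OF cw conjunct1[OF m[OF n]] cE] by simp
    qed
  qed auto
  also have "\<dots> = (\<Sum>\<nu>\<in>?T. (opE V i ^^ N) (fpow i N (c (\<nu>, N))))"
    by (subst sum.reindex) (auto simp: inj_on_def)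
  also have "\<dots> = (\<Sum>\<nu>\<in>?T. scl V (k \<nu>) (c (\<nu>, N)))"
  proof (rule sum.cong)
    fix \<nu> assume "\<nu> \<in> ?T"
    then have "height i \<nu> = of_int (m \<nu>)" using m by blast
    then show "(opE V i ^^ N) (fpow i N (c (\<nu>, N))) = scl V (k \<nu>) (c (\<nu>, N))"
      unfolding k_def by (rule E_pow_fpow[OF cw _ cE])
  qed simp
  finally have sum0: "(\<Sum>\<nu>\<in>?T. scl V (k \<nu>) (c (\<nu>, N))) = 0" by (rule sym)
  have "scl V (k \<mu>) (c (\<mu>, N)) = 0"
  proof (rule weight_components_zero[OF finT _ sum0])
    show "\<mu> \<in> ?T" using \<mu> by simp
  qed (intro subspace_scale subspace_wsp cw)
  \<comment> \<open>All factors are [m - j] with j < N, and N is at most m for the weight of a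
    nonzero component.\<close>
  moreover have "k \<mu> \<noteq> 0"
    using m[OF \<mu>] by (auto simp: k_def qint_eq_0_iff[OF symm_pos])
  ultimately show False using \<mu> by (simp add: M_def)
qed

text \<open>The difference of two families for u assembles to 0, and
  \<open>string_family_zero\<close> applies.\<close>

lemma string_family_unique: "\<exists>!c. string_family i c \<and> assemble (fpow i) c = u"
proof (rule ex_ex1I[OF string_family_exists])
  fix c d
  assume *: "string_family i c \<and> assemble (fpow i) c = u" "string_family i d \<and> assemble (fpow i) d = u"
  let ?d = "\<lambda>p. scl V (- 1) (d p)"
  have d: "string_family i ?d" using * by (intro string_family_scale) simp
  have "assemble (fpow i) (\<lambda>p. c p + ?d p) = assemble (fpow i) c + assemble (fpow i) ?d"
    using * d by (intro assemble_add[where i = i] linear_fpow) simp_all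
  also have "assemble (fpow i) ?d = scl V (- 1) (assemble (fpow i) d)"
    using * by (intro assemble_scale[where i = i] linear_fpow) simp
  finally have 0: "assemble (fpow i) (\<lambda>p. c p + ?d p) = 0" using * by simp
  have "string_family i (\<lambda>p. c p + ?d p)"
    using * d by (intro string_family_add) simp_all
  from string_family_zero[OF this 0] have "c p = d p" for p by simp
  then show "c = d" by (rule ext)
qed

text \<open>Decompose a vector into strings and apply T n to the head of each component at position
  n; uniqueness of the decomposition gives linearity. This makes the definite descriptions of both
  Kashiwara operators meaningful.\<close>

lemma string_extension:
  assumes T: "\<And>n. Vector_Spaces.linear (scl V) (scl V) (T n)"
  shows "\<exists>!g. Vector_Spaces.linear (scl V) (scl V) g \<and>
     (\<forall>\<mu> m n u. u \<in> wsp V \<mu> \<and> opE V i u = 0 \<and> height i \<mu> = of_int m \<and> int n \<le> m \<longrightarrow>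
        g (fpow i n u) = T n u)" (is "\<exists>!g. ?P g")
proof (rule ex_ex1I)
  interpret T: Vector_Spaces.linear "scl V" "scl V" "T n" for n by fact
  define c where "c u = (THE c. string_family i c \<and> assemble (fpow i) c = u)" for u
  have c: "string_family i (c u)" "assemble (fpow i) (c u) = u" for u
    using theI'[OF string_family_unique, of i u] by (simp_all add: c_def)
  have cI: "c u = d" if "string_family i d" "assemble (fpow i) d = u" for u d
    using c[of u] that string_family_unique[of i u] by blast
  have "Vector_Spaces.linear (scl V) (scl V) (\<lambda>u. assemble T (c u))"
  proof unfold_locales
    fix x y a
    have "c (x + y) = (\<lambda>p. c x p + c y p)"
      by (rule cI) (simp_all add: string_family_add c assemble_add[of "fpow i" i, OF linear_fpow])
    then show "assemble T (c (x + y)) = assemble T (c x) + assemble T (c y)"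
      by (simp add: assemble_add[of T i, OF T] c)
    have "c (scl V a x) = (\<lambda>p. scl V a (c x p))"
      by (rule cI) (simp_all add: string_family_scale c assemble_scale[of "fpow i" i, OF linear_fpow])
    then show "assemble T (c (scl V a x)) = scl V a (assemble T (c x))"
      by (simp add: assemble_scale[of T i, OF T] c)
  qed
  moreover have "assemble T (c (fpow i n u)) = T n u"
    if "u \<in> wsp V \<mu> \<and> opE V i u = 0 \<and> height i \<mu> = of_int m \<and> int n \<le> m" for \<mu> m n u
  proof -
    have "string_vector i \<mu> n u" using that by (auto simp: string_vector_def)
    then have "c (fpow i n u) = (\<lambda>p. if p = (\<mu>, n) then u else 0)"
      by (intro cI string_family_single assemble_single) (simp_all add: fpow.zero)
    then show ?thesis by (simp add: assemble_single T.zero)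
  qed
  ultimately show "\<exists>g. ?P g" by blast
next
  fix g g' assume g: "?P g" and g': "?P g'"
  interpret g: Vector_Spaces.linear "scl V" "scl V" g using g by blast
  interpret g': Vector_Spaces.linear "scl V" "scl V" g' using g' by blast
  show "g = g'"
  proof
    fix u
    obtain c where c: "string_family i c" and u: "assemble (fpow i) c = u"
      using string_family_exists by blast
    \<comment> \<open>A zero component need not satisfy the height bound under which g and g' are
      prescribed, so it is treated apart.\<close>
    have "g (fpow i n (c (\<mu>, n))) = g' (fpow i n (c (\<mu>, n)))" for \<mu> n
    proof (cases "c (\<mu>, n) = 0")
      case True
      then show ?thesis by (simp add: fpow.zero g.zero g'.zero)
    next
      case False
      then obtain m where "c (\<mu>, n) \<in> wsp V \<mu> \<and> opE V i (c (\<mu>, n)) = 0 \<and> height i \<mu> = of_int m \<and> int n \<le> m"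
        using c unfolding string_family_def string_vector_def by blast
      then show ?thesis using g g' by auto
    qed
    then show "g u = g' u"
      unfolding u[symmetric] assemble_def g.sum g'.sum by (intro sum.cong) auto
  qed
qed


section \<open>Kashiwara operators\<close>

abbreviation ke :: "'i \<Rightarrow> 'm \<Rightarrow> 'm" where "ke \<equiv> kashiwara_e D V"
abbreviation kf :: "'i \<Rightarrow> 'm \<Rightarrow> 'm" where "kf \<equiv> kashiwara_f D V"

lemma linear_kf: "Vector_Spaces.linear (scl V) (scl V) (kf i)"
  and kf_spec: "\<And>\<mu> m n u. u \<in> wsp V \<mu> \<Longrightarrow> opE V i u = 0 \<Longrightarrow> height i \<mu> = of_int m \<Longrightarrow> int n \<le> m \<Longrightarrow>
    kf i (fpow i n u) = fpow i (Suc n) u"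
proof -
  from theI'[OF string_extension[of "\<lambda>n. fpow i (n + 1)", OF linear_fpow, of i]]
  show "Vector_Spaces.linear (scl V) (scl V) (kf i)"
    "\<And>\<mu> m n u. u \<in> wsp V \<mu> \<Longrightarrow> opE V i u = 0 \<Longrightarrow> height i \<mu> = of_int m \<Longrightarrow> int n \<le> m \<Longrightarrow>
    kf i (fpow i n u) = fpow i (Suc n) u"
    unfolding kashiwara_f_def[symmetric] by simp_all
qed

lemma linear_ke: "Vector_Spaces.linear (scl V) (scl V) (ke i)"
  and ke_spec: "\<And>\<mu> m n u. u \<in> wsp V \<mu> \<Longrightarrow> opE V i u = 0 \<Longrightarrow> height i \<mu> = of_int m \<Longrightarrow> int n \<le> m \<Longrightarrow>
    ke i (fpow i n u) = (if n = 0 then 0 else fpow i (n - 1) u)"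
proof -
  have "Vector_Spaces.linear (scl V) (scl V) (\<lambda>u. if n = 0 then 0 else fpow i (n - 1) u)" for n
    by unfold_locales (simp_all add: fpow.add fpow.scale)
  from theI'[OF string_extension[of "\<lambda>n u. if n = 0 then 0 else fpow i (n - 1) u", OF this, of i]]
  show "Vector_Spaces.linear (scl V) (scl V) (ke i)"
    "\<And>\<mu> m n u. u \<in> wsp V \<mu> \<Longrightarrow> opE V i u = 0 \<Longrightarrow> height i \<mu> = of_int m \<Longrightarrow> int n \<le> m \<Longrightarrow>
    ke i (fpow i n u) = (if n = 0 then 0 else fpow i (n - 1) u)"
    unfolding kashiwara_e_def[symmetric] by simp_all
qed

interpretation kf: Vector_Spaces.linear "scl V" "scl V" "kf i" for i by (rule linear_kf)
interpretation ke: Vector_Spaces.linear "scl V" "scl V" "ke i" for i by (rule linear_ke)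

lemma string_vector_mono: "string_vector i \<mu> n u \<Longrightarrow> k \<le> n \<Longrightarrow> string_vector i \<mu> k u"
  by (force simp: string_vector_def)

lemma kf_string: "string_vector i \<mu> n u \<Longrightarrow> kf i (fpow i n u) = fpow i (Suc n) u"
  by (cases "u = 0") (auto simp: string_vector_def fpow.zero kf.zero intro: kf_spec)

lemma ke_string: "string_vector i \<mu> n u \<Longrightarrow> ke i (fpow i n u) = (if n = 0 then 0 else fpow i (n - 1) u)"
  using ke_spec[of u \<mu> i _ n] by (cases "u = 0") (auto simp: string_vector_def fpow.zero ke.zero)

lemma ke_pow_string:
  assumes "string_vector i \<mu> n u"
  shows "(ke i ^^ k) (fpow i n u) = (if k \<le> n then fpow i (n - k) u else 0)"
proof (induction k)
  case (Suc k)
  then show ?case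
    using ke_string[OF string_vector_mono[OF assms, of "n - k"]] by (auto simp: ke.zero Suc_diff_le)
qed simp

lemma weight_vector_stringsE:
  assumes "u \<in> wsp V \<mu>"
  obtains c N where "\<And>n. string_vector i (\<mu> + of_nat n *s simple_root D i) n (c n)"
    and "u = (\<Sum>n<N. fpow i n (c n))"
proof -
  obtain N where "(opE V i ^^ N) u = 0" using E_nilpotent by blast
  from weight_vector_strings[OF assms this] that show ?thesis by blast
qed

text \<open>A component at position n has its head n simple roots above u; moving it to position n +
  1 therefore lands one root below u.\<close>

lemma wsp_kf:
  assumes "u \<in> wsp V \<mu>"
  shows "kf i u \<in> wsp V (\<mu> - simple_root D i)"
proof -
  obtain c N where c: "\<And>n. string_vector i (\<mu> + of_nat n *s simple_root D i) n (c n)"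
    and u: "u = (\<Sum>n<N. fpow i n (c n))" using weight_vector_stringsE[OF assms] by blast
  have "root_shift (\<mu> + of_nat n *s simple_root D i) i (Suc n) = \<mu> - simple_root D i" for n
    by (simp add: vec_eq_iff algebra_simps)
  then have "fpow i (Suc n) (c n) \<in> wsp V (\<mu> - simple_root D i)" for n
    using wsp_fpow[of "c n" _ i "Suc n"] c[of n] unfolding string_vector_def by metis
  then show ?thesis
    unfolding u kf.sum by (intro subspace_sum subspace_wsp) (simp add: kf_string[OF c])
qed

lemma wsp_ke:
  assumes "u \<in> wsp V \<mu>"
  shows "ke i u \<in> wsp V (\<mu> + simple_root D i)"
proof -
  obtain c N where c: "\<And>n. string_vector i (\<mu> + of_nat n *s simple_root D i) n (c n)"
    and u: "u = (\<Sum>n<N. fpow i n (c n))" using weight_vector_stringsE[OF assms] by blast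
  have "root_shift (\<mu> + of_nat (Suc n) *s simple_root D i) i n = \<mu> + simple_root D i" for n
    by (simp add: vec_eq_iff algebra_simps)
  then have "fpow i n (c (Suc n)) \<in> wsp V (\<mu> + simple_root D i)" for n
    using wsp_fpow[of "c (Suc n)" _ i n] c[of "Suc n"] unfolding string_vector_def by metis
  then have "ke i (fpow i n (c n)) \<in> wsp V (\<mu> + simple_root D i)" for n
    unfolding ke_string[OF c] by (cases n) (simp_all add: subspace_0 subspace_wsp)
  then show ?thesis
    unfolding u ke.sum by (intro subspace_sum subspace_wsp)
qed

text \<open>Only positions n < N occur in u, and N applications of \<open>ke i\<close> push each of
  them past its head.\<close>

lemma ke_nilpotent:
  assumes "u \<in> wsp V \<mu>"
  shows "\<exists>N. (ke i ^^ N) u = 0"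
proof -
  obtain c N where c: "\<And>n. string_vector i (\<mu> + of_nat n *s simple_root D i) n (c n)"
    and u: "u = (\<Sum>n<N. fpow i n (c n))" using weight_vector_stringsE[OF assms] by blast
  interpret P: Vector_Spaces.linear "scl V" "scl V" "\<lambda>u. (ke i ^^ N) u"
    by (intro linear_funpow linear_ke)
  have "(ke i ^^ N) u = 0"
    unfolding u P.sum by (intro sum.neutral) (simp add: ke_pow_string[OF c])
  then show ?thesis by blast
qed

text \<open>The composite of \<open>kf i\<close> and \<open>ke i\<close> fixes every component at a
  positive position and kills the one at position 0, so the difference is that last component, a
  string head.\<close>

lemma kf_ke_primitive:
  assumes u: "u \<in> wsp V \<mu>"
  shows "opE V i (u - kf i (ke i u)) = 0"
proof -
  obtain c N where c: "\<And>n. string_vector i (\<mu> + of_nat n *s simple_root D i) n (c n)"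
    and u: "u = (\<Sum>n<N. fpow i n (c n))" using weight_vector_stringsE[OF assms] by blast
  have *: "kf i (ke i (fpow i n (c n))) = (if n = 0 then 0 else fpow i n (c n))" for n
    using kf_string[OF string_vector_mono[OF c[of n], of "n - 1"]]
    by (simp add: ke_string[OF c] kf.zero)
  have "u - kf i (ke i u) = (\<Sum>n<N. fpow i n (c n) - kf i (ke i (fpow i n (c n))))"
    by (simp only: u kf.sum ke.sum sum_subtractf)
  also have "opE V i \<dots> = 0"
    unfolding E.sum * using c[of 0] by (intro sum.neutral) (simp add: string_vector_def E.zero)
  finally show ?thesis .
qed

section \<open>Spans over the local ring at q = 0\<close>

lemma regular_span_add:
  assumes "x \<in> regular_span V X" and "y \<in> regular_span V X"
  shows "x + y \<in> regular_span V X"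
proof -
  obtain S c where x: "x = (\<Sum>z\<in>S. scl V (c z) z)" and S: "finite S" "S \<subseteq> X" "c ` S \<subseteq> regular_at_0"
    using assms(1) unfolding regular_span_def by blast
  obtain T d where y: "y = (\<Sum>z\<in>T. scl V (d z) z)" and T: "finite T" "T \<subseteq> X" "d ` T \<subseteq> regular_at_0"
    using assms(2) unfolding regular_span_def by blast
  define e where "e z = (if z \<in> S then c z else 0) + (if z \<in> T then d z else 0)" for z
  have reg: "c z \<in> regular_at_0" if "z \<in> S" for z using S that by blast
  have reg': "d z \<in> regular_at_0" if "z \<in> T" for z using T that by blast
  have "x = (\<Sum>z\<in>S \<union> T. scl V (if z \<in> S then c z else 0) z)"
    unfolding x by (rule sum.mono_neutral_cong_left) (use S T in auto)
  moreover have "y = (\<Sum>z\<in>S \<union> T. scl V (if z \<in> T then d z else 0) z)"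
    unfolding y by (rule sum.mono_neutral_cong_left) (use S T in auto)
  ultimately have "x + y = (\<Sum>z\<in>S \<union> T. scl V (e z) z)"
    by (simp only: e_def scale_left_distrib sum.distrib)
  moreover have "e ` (S \<union> T) \<subseteq> regular_at_0"
    by (auto simp: e_def intro!: regular_at_0_add zero_regular_at_0 reg reg')
  ultimately show ?thesis
    using S T unfolding regular_span_def by (intro CollectI exI[of _ "S \<union> T"] exI[of _ e]) simp
qed

lemma regular_span_uminus:
  assumes "x \<in> regular_span V X"
  shows "- x \<in> regular_span V X"
proof -
  obtain S c where x: "x = (\<Sum>z\<in>S. scl V (c z) z)" and S: "finite S" "S \<subseteq> X" "c ` S \<subseteq> regular_at_0"
    using assms(1) unfolding regular_span_def by blast
  have "- x = (\<Sum>z\<in>S. scl V (- c z) z)" by (simp add: x sum_negf)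
  moreover have "(\<lambda>z. - c z) ` S \<subseteq> regular_at_0" using S by (auto intro: regular_at_0_uminus)
  ultimately show ?thesis
    using S unfolding regular_span_def by (intro CollectI exI[of _ S] exI[of _ "\<lambda>z. - c z"]) simp
qed

lemma regular_span_base: "x \<in> X \<Longrightarrow> x \<in> regular_span V X"
  unfolding regular_span_def
  by (intro CollectI exI[of _ "{x}"] exI[of _ "\<lambda>_. 1"]) (simp add: one_regular_at_0)

end


section \<open>The crystal of a highest weight module\<close>

locale hw_crystal = integrable_uq_module D V
  for D :: "('i::finite, 'r::finite) root_datum" and V :: "('i, 'r, 'm::ab_group_add) uq_module" +
  fixes \<Lambda> :: "complex^'r" and v :: 'm and L :: "'m set" and B :: "'m set set"
  assumes highest_weight: "v \<in> wsp V \<Lambda>" "v \<noteq> 0"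
    and crystal: "hw_crystal_base D V v L B"
begin

interpretation kf: Vector_Spaces.linear "scl V" "scl V" "kf i" for i by (rule linear_kf)
interpretation ke: Vector_Spaces.linear "scl V" "scl V" "ke i" for i by (rule linear_ke)

abbreviation qL :: "'m set" where
  "qL \<equiv> scl V qvar ` L"

abbreviation arr :: "'i \<Rightarrow> 'm set \<Rightarrow> 'm set \<Rightarrow> bool" where
  "arr \<equiv> crystal_arrow D V L B"

lemma L_def: "L = regular_span V (f_monomials D V v)"
  and B_def: "B = qcoset V L ` f_monomials D V v - {qcoset V L 0}"
  and crystal_base: "crystal_base D V L B"
  using crystal unfolding hw_crystal_base_def by blast+

lemma full_lattice: "full_lattice V L"
  and basis_mod_q: "basis_mod_q V L B"
  and weight_components_L: "\<And>u c. u \<in> L \<Longrightarrow> weight_decomp V u c \<Longrightarrow> range c \<subseteq> L"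
  and ke_image_L: "\<And>i. ke i ` L \<subseteq> L"
  and kf_image_L: "\<And>i. kf i ` L \<subseteq> L"
  and induced_ke_B: "\<And>i b. b \<in> B \<Longrightarrow> induced V L (ke i) b \<in> B \<union> {qcoset V L 0}"
  and induced_kf_B: "\<And>i b. b \<in> B \<Longrightarrow> induced V L (kf i) b \<in> B \<union> {qcoset V L 0}"
  and induced_kf_eq_iff: "\<And>i b b'. b \<in> B \<Longrightarrow> b' \<in> B \<Longrightarrow>
    induced V L (kf i) b = b' \<longleftrightarrow> induced V L (ke i) b' = b"
  using crystal_base unfolding crystal_base_def by simp_all

section \<open>The lattice L and its cosets modulo qL\<close>

lemma L_add: "x \<in> L \<Longrightarrow> y \<in> L \<Longrightarrow> x + y \<in> L"
  and L_uminus: "x \<in> L \<Longrightarrow> - x \<in> L"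
  unfolding L_def by (rule regular_span_add regular_span_uminus; assumption)+

lemma f_monomials_L: "x \<in> f_monomials D V v \<Longrightarrow> x \<in> L"
  unfolding L_def by (rule regular_span_base)

lemma v_L: "v \<in> L"
  by (rule f_monomials_L) (auto simp: f_monomials_def intro: exI[of _ "[]"])

lemma L_diff: "x \<in> L \<Longrightarrow> y \<in> L \<Longrightarrow> x - y \<in> L"
  using L_add[of x "- y"] L_uminus by simp

lemma L_0: "0 \<in> L"
  using L_diff[OF v_L v_L] by simp

lemma qL_add: "x \<in> qL \<Longrightarrow> y \<in> qL \<Longrightarrow> x + y \<in> qL"
  by (auto simp: scale_right_distrib[symmetric] intro: L_add)

lemma qL_uminus: "x \<in> qL \<Longrightarrow> - x \<in> qL"
  by (auto simp: scale_minus_right[symmetric] simp del: scale_minus_right intro: L_uminus)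

lemma qL_0: "0 \<in> qL"
  using L_0 by (metis image_eqI scale_zero_right)

lemma mem_qcoset: "x \<in> qcoset V L u \<longleftrightarrow> x - u \<in> qL"
  by (auto simp: qcoset_def image_iff algebra_simps)

lemma qcoset_eq_iff: "qcoset V L u = qcoset V L u' \<longleftrightarrow> u - u' \<in> qL"
proof
  assume "qcoset V L u = qcoset V L u'"
  then show "u - u' \<in> qL" using mem_qcoset[of u u] mem_qcoset[of u u'] qL_0 by simp
next
  assume *: "u - u' \<in> qL"
  have "x - u \<in> qL \<longleftrightarrow> x - u' \<in> qL" for x
    using qL_add[of "x - u" "u - u'"] qL_add[of "x - u'" "- (u - u')"] qL_uminus[OF *] * by auto
  then show "qcoset V L u = qcoset V L u'" by (auto simp: mem_qcoset)
qed

lemma qcoset_eq_0_iff: "qcoset V L u = qcoset V L 0 \<longleftrightarrow> u \<in> qL"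
  by (simp add: qcoset_eq_iff)

lemma zero_notin_B: "qcoset V L 0 \<notin> B"
  by (simp add: B_def)

lemma kf_L: "u \<in> L \<Longrightarrow> kf i u \<in> L"
  and ke_L: "u \<in> L \<Longrightarrow> ke i u \<in> L"
  using kf_image_L ke_image_L by blast+

lemma kf_qL: "u \<in> qL \<Longrightarrow> kf i u \<in> qL"
  by (auto simp: kf.scale intro: kf_L)

lemma ke_qL: "u \<in> qL \<Longrightarrow> ke i u \<in> qL"
  by (auto simp: ke.scale intro: ke_L)

text \<open>Since \<open>kf i\<close> preserves qL, all cosets in the union defining
  \<open>induced\<close> coincide.\<close>

lemma induced_kf: "induced V L (kf i) (qcoset V L u) = qcoset V L (kf i u)"
proof -
  have "qcoset V L (kf i x) = qcoset V L (kf i u)" if "x \<in> qcoset V L u" for x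
    using that kf_qL[of "x - u" i] by (simp add: mem_qcoset qcoset_eq_iff kf.diff)
  moreover have "u \<in> qcoset V L u" using qL_0 by (simp add: mem_qcoset)
  ultimately show ?thesis unfolding induced_def by blast
qed

lemma induced_ke: "induced V L (ke i) (qcoset V L u) = qcoset V L (ke i u)"
proof -
  have "qcoset V L (ke i x) = qcoset V L (ke i u)" if "x \<in> qcoset V L u" for x
    using that ke_qL[of "x - u" i] by (simp add: mem_qcoset qcoset_eq_iff ke.diff)
  moreover have "u \<in> qcoset V L u" using qL_0 by (simp add: mem_qcoset)
  ultimately show ?thesis unfolding induced_def by blast
qed

text \<open>A basis element x lying in qL would be q times a regular combination of the basis.
  Comparing coefficients at x would make q invertible in the local ring.\<close>

lemma L_not_subset_qL: "\<not> L \<subseteq> qL"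
proof
  assume sub: "L \<subseteq> qL"
  obtain X where X: "\<not> dependent X" "span X = UNIV" "L = regular_span V X"
    using full_lattice unfolding full_lattice_def by blast
  have "X \<noteq> {}" using X(2) highest_weight(2) by (metis UNIV_I empty_iff insert_iff span_empty)
  then obtain x where x: "x \<in> X" by blast
  then have "x \<in> qL" using sub X(3) regular_span_base by blast
  then obtain S c where xc: "x = scl V qvar (\<Sum>y\<in>S. scl V (c y) y)"
    and S: "finite S" "S \<subseteq> X" "c ` S \<subseteq> regular_at_0"
    unfolding X(3) regular_span_def by blast
  \<comment> \<open>These are the coefficients of the relation q(sum) - x = 0; at x itself the value
    is q times a regular function minus 1, or -1 if x is outside S.\<close>
  define d where "d y = (if y \<in> S then qvar * c y else 0) - (if y = x then 1 else 0)" for y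
  have "(\<Sum>y\<in>insert x S. scl V (if y \<in> S then qvar * c y else 0) y) = (\<Sum>y\<in>S. scl V (qvar * c y) y)"
    by (rule sum.mono_neutral_cong_right) (use S in auto)
  moreover have "(\<Sum>y\<in>insert x S. scl V (if y = x then 1 else 0) y) = (\<Sum>y\<in>{x}. y)"
    by (rule sum.mono_neutral_cong_right) (use S in auto)
  ultimately have "(\<Sum>y\<in>insert x S. scl V (d y) y) = (\<Sum>y\<in>S. scl V (qvar * c y) y) - x"
    by (simp only: d_def scale_left_diff_distrib sum_subtractf) simp
  also have "\<dots> = 0" by (subst xc) (simp add: scale_sum_right)
  finally have "d x = 0"
    using independentD[OF X(1), of "insert x S" d x] S x by simp
  moreover have "d x \<noteq> 0"
    using S(3) qvar_times_regular_ne_1[of "c x"] by (auto simp: d_def)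
  ultimately show False by simp
qed

text \<open>Otherwise all monomials in the \<open>kf i\<close> applied to v lie in qL, so B is
  empty. An empty basis of L/qL forces L into qL.\<close>

lemma v_notin_qL: "v \<notin> qL"
proof
  assume v: "v \<in> qL"
  have "foldr kf is v \<in> qL" for "is"
    by (induction "is") (simp_all add: v kf_qL)
  then have "qcoset V L x = qcoset V L 0" if "x \<in> f_monomials D V v" for x
    using that qcoset_eq_0_iff by (auto simp only: f_monomials_def mem_Collect_eq)
  then have "B = {}" unfolding B_def by blast
  have "\<exists>X\<subseteq>L. inj_on (qcoset V L) X \<and> B = qcoset V L ` X \<and>
        (\<forall>u\<in>L. \<exists>!c. finite {x. c x \<noteq> 0} \<and> {x. c x \<noteq> 0} \<subseteq> X \<and>
           u \<in> qcoset V L (\<Sum>x | c x \<noteq> 0. scl V (rat_const (c x)) x))"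
    using basis_mod_q unfolding basis_mod_q_def .
  then obtain X where X: "X \<subseteq> L \<and> inj_on (qcoset V L) X \<and> B = qcoset V L ` X \<and>
        (\<forall>u\<in>L. \<exists>!c. finite {x. c x \<noteq> 0} \<and> {x. c x \<noteq> 0} \<subseteq> X \<and>
           u \<in> qcoset V L (\<Sum>x | c x \<noteq> 0. scl V (rat_const (c x)) x))" (is "_ \<and> _ \<and> _ \<and> (\<forall>u\<in>L. ?R u)")
    by (rule exE) (rule that)
  then have "X = {}" using \<open>B = {}\<close> by (metis image_is_empty)
  have "u \<in> qL" if u: "u \<in> L" for u
  proof -
    from X u have "?R u" by blast
    from ex1_implies_ex[OF this] show ?thesis
      by (rule exE) (auto simp: \<open>X = {}\<close> mem_qcoset)
  qed
  with L_not_subset_qL show False by blast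
qed

text \<open>This is the weight function wt of the crystal, written as a relation because it refers
  to a choice of representative; on B the weight is unique by the next lemma.\<close>

definition has_weight :: "'m set \<Rightarrow> complex^'r \<Rightarrow> bool" where
  "has_weight b \<mu> \<longleftrightarrow> (\<exists>u\<in>L \<inter> wsp V \<mu>. b = qcoset V L u)"

text \<open>Representatives of different weights differ by some q l with l in L. The weight
  components of l lie in L as well, so taking the component of weight mu puts u in qL, making b the
  zero class.\<close>

lemma has_weight_unique:
  assumes b: "b \<in> B" and "has_weight b \<mu>" and "has_weight b \<nu>"
  shows "\<mu> = \<nu>"
proof (rule ccontr)
  assume ne: "\<mu> \<noteq> \<nu>"
  obtain u u' where u: "u \<in> L" "u \<in> wsp V \<mu>" "b = qcoset V L u"
    and u': "u' \<in> L" "u' \<in> wsp V \<nu>" "b = qcoset V L u'"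
    using assms unfolding has_weight_def by blast
  have "u - u' \<in> qL" using u u' qcoset_eq_iff by metis
  then obtain l where l: "l \<in> L" "u - u' = scl V qvar l" by blast
  obtain c where c: "weight_decomp V l c" using weight_decomp_unique by blast
  then have cL: "c \<kappa> \<in> L" for \<kappa>
    using weight_components_L[OF l(1)] by blast
  have cw: "c \<kappa> \<in> wsp V \<kappa>" and fin: "finite {\<kappa>. c \<kappa> \<noteq> 0}" and lc: "l = (\<Sum>\<kappa> | c \<kappa> \<noteq> 0. c \<kappa>)" for \<kappa>
    using c by (simp_all add: weight_decomp_def)
  let ?M = "{\<mu>, \<nu>} \<union> {\<kappa>. c \<kappa> \<noteq> 0}"
  define x where "x \<kappa> = (if \<kappa> = \<mu> then u else 0) - (if \<kappa> = \<nu> then u' else 0) - scl V qvar (c \<kappa>)" for \<kappa>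
  have finM: "finite ?M" using fin by simp
  have xw: "x \<kappa> \<in> wsp V \<kappa>" for \<kappa>
    unfolding x_def
    by (intro subspace_diff subspace_wsp subspace_scale cw) (auto simp: u u' subspace_0 subspace_wsp)
  have "(\<Sum>\<kappa>\<in>?M. scl V qvar (c \<kappa>)) = scl V qvar l"
    unfolding lc scale_sum_right by (rule sum.mono_neutral_right[OF finM]) auto
  then have "(\<Sum>\<kappa>\<in>?M. x \<kappa>) = 0"
    unfolding x_def sum_subtractf using finM l(2) by simp
  from weight_components_zero[OF finM xw this, of \<mu>] have "u = scl V qvar (c \<mu>)"
    using ne by (simp add: x_def)
  then have "b = qcoset V L 0" using u(3) cL qcoset_eq_0_iff by blast
  with b zero_notin_B show False by simp
qed

text \<open>Climb with \<open>ke i\<close> until the class becomes zero; there a primitive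
  representative exists. On the way back, \<open>induced_kf_eq_iff\<close> ensures that
  \<open>kf i\<close> retraces the climb.\<close>

lemma crystal_string_exists:
  assumes "b \<in> B" and "u \<in> L" and "u \<in> wsp V \<mu>" and "b = qcoset V L u" and "(ke i ^^ N) u = 0"
  shows "\<exists>u\<^sub>0 \<nu> m k. u\<^sub>0 \<in> L \<and> u\<^sub>0 \<in> wsp V \<nu> \<and> opE V i u\<^sub>0 = 0 \<and> height i \<nu> = of_int (int m) \<and>
    k \<le> m \<and> qcoset V L u\<^sub>0 \<in> B \<and> b = qcoset V L (fpow i k u\<^sub>0)"
  using assms
proof (induction N arbitrary: b u \<mu>)
  case 0
  then show ?case using zero_notin_B by simp
next
  case (Suc N)
  note u = Suc.prems(2,3) and b = Suc.prems(1,4)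
  have u_notin: "u \<notin> qL" using b zero_notin_B qcoset_eq_0_iff by metis
  show ?case
  proof (cases "ke i u \<in> qL")
    case True
    \<comment> \<open>Here \<open>ke i u\<close> vanishes only modulo qL. The correction stays in
      qL, so the class is unchanged while the new representative is killed by \<open>opE\<close>
      exactly.\<close>
    define u\<^sub>0 where "u\<^sub>0 = u - kf i (ke i u)"
    have q: "kf i (ke i u) \<in> qL" by (rule kf_qL[OF True])
    have "kf i (ke i u) \<in> wsp V \<mu>" using wsp_kf[OF wsp_ke[OF u(2)], of i i] by simp
    then have u0w: "u\<^sub>0 \<in> wsp V \<mu>"
      unfolding u\<^sub>0_def by (intro subspace_diff subspace_wsp u)
    have u0L: "u\<^sub>0 \<in> L" unfolding u\<^sub>0_def by (intro L_diff kf_L ke_L u)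
    have E0: "opE V i u\<^sub>0 = 0" unfolding u\<^sub>0_def by (rule kf_ke_primitive[OF u(2)])
    have bu: "b = qcoset V L u\<^sub>0" unfolding b(2) qcoset_eq_iff u\<^sub>0_def using q by simp
    then have ne: "u\<^sub>0 \<noteq> 0" using b zero_notin_B by auto
    obtain m where m: "height i \<mu> = of_int m" using wsp_integral[OF u0w ne] .
    \<comment> \<open>With exponent 0, negative height would force the vector itself to
      vanish.\<close>
    have "m \<ge> 0" using F_pow_vanish[OF u0w m E0, of 0] ne by force
    then have "height i \<mu> = of_int (int (nat m))" using m by simp
    moreover have "b = qcoset V L (fpow i 0 u\<^sub>0)" using bu by simp
    ultimately show ?thesis using u0L u0w E0 bu b(1)
      by (intro exI[of _ u\<^sub>0] exI[of _ \<mu>] exI[of _ "nat m"] exI[of _ 0]) simp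
  next
    case False
    define b\<^sub>1 where "b\<^sub>1 = qcoset V L (ke i u)"
    have b1: "b\<^sub>1 = induced V L (ke i) b" by (simp add: b\<^sub>1_def b induced_ke)
    have b1B: "b\<^sub>1 \<in> B"
      using induced_ke_B[OF b(1), of i] False unfolding b1[symmetric] by (simp add: b\<^sub>1_def qcoset_eq_0_iff)
    have "(ke i ^^ N) (ke i u) = 0"
      using Suc.prems(5) by (simp add: funpow_Suc_right del: funpow.simps)
    from Suc.IH[OF b1B ke_L[OF u(1)] wsp_ke[OF u(2)] b\<^sub>1_def this]
    obtain u\<^sub>0 \<nu> m k where u0: "u\<^sub>0 \<in> L" "u\<^sub>0 \<in> wsp V \<nu>" "opE V i u\<^sub>0 = 0" "height i \<nu> = of_int (int m)"
      and k: "k \<le> m" and u0B: "qcoset V L u\<^sub>0 \<in> B" and b1k: "b\<^sub>1 = qcoset V L (fpow i k u\<^sub>0)" by blast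
    have "induced V L (kf i) b\<^sub>1 = b" using induced_kf_eq_iff[OF b1B b(1)] b1 by simp
    then have bk: "b = qcoset V L (fpow i (Suc k) u\<^sub>0)"
      using kf_spec[OF u0(2,3,4)] k by (simp add: b1k induced_kf)
    \<comment> \<open>If k = m, the next divided power is zero and b would be the zero
      class.\<close>
    have "Suc k \<le> m"
    proof (rule ccontr)
      assume "\<not> Suc k \<le> m"
      then have "fpow i (Suc k) u\<^sub>0 = 0" by (intro fpow_vanish[OF u0(2,4,3)]) simp
      then show False using bk b zero_notin_B by simp
    qed
    then show ?thesis using u0 u0B bk by blast
  qed
qed

text \<open>The string through b consists of the classes of divided powers 0 to m of a primitive
  vector. Reflection moves b from position k to m - k, which subtracts m - 2k simple roots, and m -
  2k is the height of mu.\<close>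

lemma string_mirror_weight:
  assumes b: "b \<in> B" and w: "has_weight b \<mu>"
  shows "string_mirror arr i b \<in> B" and "has_weight (string_mirror arr i b) (simple_reflection D i \<mu>)"
proof -
  obtain u where u: "u \<in> L" "u \<in> wsp V \<mu>" "b = qcoset V L u"
    using w unfolding has_weight_def by blast
  obtain N where "(ke i ^^ N) u = 0" using ke_nilpotent[OF u(2)] by blast
  from crystal_string_exists[OF b u this]
  obtain u\<^sub>0 \<nu> m k where u0: "u\<^sub>0 \<in> L" "u\<^sub>0 \<in> wsp V \<nu>" "opE V i u\<^sub>0 = 0" "height i \<nu> = of_int (int m)"
    and k: "k \<le> m" and u0B: "qcoset V L u\<^sub>0 \<in> B" and bk: "b = qcoset V L (fpow i k u\<^sub>0)" by blast
  define \<beta> where "\<beta> j = qcoset V L (fpow i j u\<^sub>0)" for j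
  have str: "string_vector i \<nu> j u\<^sub>0" if "j \<le> m" for j
    unfolding string_vector_def using u0 that by (auto intro!: exI[of _ "int m"])
  have u0q: "u\<^sub>0 \<notin> qL" using u0B zero_notin_B qcoset_eq_0_iff by metis
  \<comment> \<open>Applying \<open>ke i\<close> j times preserves qL and returns to
    \<open>u\<^sub>0\<close>, whose class is nonzero.\<close>
  have notin: "fpow i j u\<^sub>0 \<notin> qL" if "j \<le> m" for j
  proof
    assume *: "fpow i j u\<^sub>0 \<in> qL"
    have "(ke i ^^ n) x \<in> qL" if "x \<in> qL" for n x
      using that by (induction n) (simp_all add: ke_qL)
    from this[OF *, of j] show False using u0q ke_pow_string[OF str[OF that], of j] by simp
  qed
  have \<beta>: "fpow i j u\<^sub>0 \<in> L \<and> \<beta> j \<in> B" if "j \<le> m" for j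
    using that
  proof (induction j)
    case 0
    then show ?case using u0 u0B by (simp add: \<beta>_def)
  next
    case (Suc j)
    have kf: "kf i (fpow i j u\<^sub>0) = fpow i (Suc j) u\<^sub>0" using kf_string[OF str] Suc.prems by simp
    have "\<beta> (Suc j) \<noteq> qcoset V L 0" using notin[OF Suc.prems] by (simp add: \<beta>_def qcoset_eq_0_iff)
    then have "\<beta> (Suc j) \<in> B"
      using induced_kf_B[of "\<beta> j" i] Suc by (simp add: \<beta>_def induced_kf kf)
    moreover have "fpow i (Suc j) u\<^sub>0 \<in> L" using kf_L[of "fpow i j u\<^sub>0" i] Suc kf by simp
    ultimately show ?case by blast
  qed
  have succ: "arr i (\<beta> j) x \<longleftrightarrow> j < m \<and> x = \<beta> (Suc j)" if "j \<le> m" for j x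
  proof (cases "j = m")
    case True
    then have "induced V L (kf i) (\<beta> j) = qcoset V L 0"
      using fpow_vanish[OF u0(2,4,3), of "Suc m"] kf_string[OF str[OF that]] by (simp add: \<beta>_def induced_kf)
    then show ?thesis using True zero_notin_B by (auto simp: crystal_arrow_def)
  next
    case False
    then have "induced V L (kf i) (\<beta> j) = \<beta> (Suc j)"
      using kf_string[OF str[OF that]] by (simp add: \<beta>_def induced_kf)
    then show ?thesis using False that \<beta>[of j] \<beta>[of "Suc j"] by (auto simp: crystal_arrow_def)
  qed
  have pred: "arr i x (\<beta> j) \<longleftrightarrow> 0 < j \<and> x = \<beta> (j - 1)" if "j \<le> m" for j x
  proof -
    \<comment> \<open>The inverse relation of the crystal base turns incoming arrows into values of
      the induced \<open>ke i\<close>, so there is at most one.\<close>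
    have "arr i x (\<beta> j) \<longleftrightarrow> x \<in> B \<and> x = induced V L (ke i) (\<beta> j)"
      using \<beta>[OF that] induced_kf_eq_iff[of x "\<beta> j" i] unfolding crystal_arrow_def by metis
    moreover have "induced V L (ke i) (\<beta> j) = (if j = 0 then qcoset V L 0 else \<beta> (j - 1))"
      using ke_string[OF str[OF that]] by (simp add: \<beta>_def induced_ke)
    moreover have "\<beta> (j - 1) \<in> B" using \<beta>[of "j - 1"] that by simp
    ultimately show ?thesis using zero_notin_B by auto
  qed
  have mirror: "string_mirror arr i b = \<beta> (m - k)"
    unfolding bk \<beta>_def[symmetric] by (rule string_mirror_chain[where arr = arr and i = i and \<beta> = \<beta> and m = m, OF succ pred k])
  show "string_mirror arr i b \<in> B" unfolding mirror using \<beta>[of "m - k"] by simp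
  have weight: "has_weight (\<beta> j) (root_shift \<nu> i j)" if "j \<le> m" for j
    unfolding has_weight_def \<beta>_def using \<beta>[OF that] wsp_fpow[OF u0(2)] by blast
  have \<mu>: "\<mu> = root_shift \<nu> i k"
    using has_weight_unique[OF b w] weight[OF k] by (simp add: bk \<beta>_def)
  have "height i \<mu> = of_nat m - 2 * of_nat k"
    unfolding \<mu> height_shift[OF u0(4)] by simp
  then have "simple_reflection D i \<mu> = \<mu> - (of_nat m - 2 * of_nat k) *s simple_root D i"
    by (simp only: simple_reflection_def)
  also have "\<dots> = root_shift \<nu> i (m - k)"
    using k by (simp add: \<mu> vec_eq_iff of_nat_diff algebra_simps)
  finally have "simple_reflection D i \<mu> = root_shift \<nu> i (m - k)" .
  with weight[of "m - k"] show "has_weight (string_mirror arr i b) (simple_reflection D i \<mu>)"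
    by (simp add: mirror)
qed

lemma highest_weight_vertex: "qcoset V L v \<in> B" "has_weight (qcoset V L v) \<Lambda>"
proof -
  have "v \<in> f_monomials D V v" by (auto simp: f_monomials_def intro: exI[of _ "[]"])
  then show "qcoset V L v \<in> B"
    unfolding B_def using v_notin_qL qcoset_eq_0_iff by blast
  show "has_weight (qcoset V L v) \<Lambda>"
    unfolding has_weight_def using v_L highest_weight by blast
qed

text \<open>By induction along the chosen expression of w, each reflection of a string acts on the
  weight as the simple reflection. The resulting weight depends on w alone.\<close>

lemma weyl_acts_weight:
  assumes "weyl_acts D arr w b b'" and "b \<in> B" and "has_weight b \<mu>"
  shows "b' \<in> B \<and> has_weight b' (w \<mu>)"
  using assms by induction (auto intro: string_mirror_weight)

section \<open>Weights along paths and the depth of a vertex\<close>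

lemma arr_weight:
  assumes "arr i b b'" and "has_weight b \<mu>"
  shows "has_weight b' (\<mu> - simple_root D i)"
proof -
  obtain u where u: "u \<in> L" "u \<in> wsp V \<mu>" "b = qcoset V L u"
    using assms unfolding has_weight_def by blast
  then have "b' = qcoset V L (kf i u)" using assms by (simp add: crystal_arrow_def induced_kf)
  then show ?thesis unfolding has_weight_def using kf_L[OF u(1)] wsp_kf[OF u(2)] by blast
qed

lemma path_weight:
  assumes \<rho>: "\<And>i. pairing (simple_root D i) \<rho> = 1"
    and "((\<lambda>x y. \<exists>i. arr i x y) ^^ n) (qcoset V L v) b"
  shows "\<exists>\<mu>. has_weight b \<mu> \<and> pairing (\<Lambda> - \<mu>) \<rho> = of_nat n"
  using assms(2)
proof (induction n arbitrary: b)
  case 0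
  then show ?case using highest_weight_vertex by (auto intro!: exI[of _ \<Lambda>] simp: pairing_diff)
next
  case (Suc n)
  then obtain b' i where "((\<lambda>x y. \<exists>i. arr i x y) ^^ n) (qcoset V L v) b'" and i: "arr i b' b"
    by auto
  then obtain \<mu> where "has_weight b' \<mu>" "pairing (\<Lambda> - \<mu>) \<rho> = of_nat n" using Suc.IH by blast
  then show ?case
    using arr_weight[OF i] by (intro exI[of _ "\<mu> - simple_root D i"]) (simp add: pairing_diff \<rho>)
qed

text \<open>Every vertex is the class of a monomial in the \<open>kf i\<close> applied to v. Its
  partial monomials have nonzero classes too, so applying the operators one at a time traces a path
  inside B.\<close>

lemma path_exists:
  assumes "b \<in> B"
  shows "\<exists>n. ((\<lambda>x y. \<exists>i. arr i x y) ^^ n) (qcoset V L v) b"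
proof -
  have "((\<lambda>x y. \<exists>i. arr i x y) ^^ length is) (qcoset V L v) (qcoset V L (foldr kf is v)) \<and>
      qcoset V L (foldr kf is v) \<in> B"
    if "foldr kf is v \<notin> qL" for "is"
    using that
  proof (induction "is")
    case (Cons i "is")
    let ?u = "foldr kf is v"
    \<comment> \<open>If the shorter monomial were in qL, applying \<open>kf i\<close> would keep it
      there.\<close>
    have "?u \<notin> qL" using Cons.prems kf_qL[of ?u i] by auto
    note IH = Cons.IH[OF this]
    have "kf i ?u \<in> f_monomials D V v"
      unfolding f_monomials_def by (auto intro!: exI[of _ "i # is"])
    then have B: "qcoset V L (kf i ?u) \<in> B"
      unfolding B_def using Cons.prems qcoset_eq_0_iff[of "kf i ?u"] by auto
    then have "arr i (qcoset V L ?u) (qcoset V L (kf i ?u))"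
      using IH by (simp add: crystal_arrow_def induced_kf)
    then show ?case using IH B by (auto intro: relcomppI)
  qed (simp add: highest_weight_vertex)
  moreover obtain "is" where "b = qcoset V L (foldr kf is v)" and "foldr kf is v \<notin> qL"
    using assms unfolding B_def f_monomials_def qcoset_eq_0_iff[symmetric] by blast
  ultimately show ?thesis by blast
qed

text \<open>The unique weight of b fixes the length of every path to it, so the definite description
  in \<open>depth\<close> denotes this common length.\<close>

lemma depth_eq:
  assumes \<rho>: "\<And>i. pairing (simple_root D i) \<rho> = 1"
    and b: "b \<in> B" and w: "has_weight b \<mu>"
  shows "of_nat (depth arr (qcoset V L v) b) = pairing (\<Lambda> - \<mu>) \<rho>"
proof -
  have len: "pairing (\<Lambda> - \<mu>) \<rho> = of_nat n"
    if n: "((\<lambda>x y. \<exists>i. arr i x y) ^^ n) (qcoset V L v) b" for n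
    using path_weight[OF \<rho> n] has_weight_unique[OF b w] by blast
  obtain n where n: "((\<lambda>x y. \<exists>i. arr i x y) ^^ n) (qcoset V L v) b" using path_exists[OF b] by blast
  have "depth arr (qcoset V L v) b = n"
    unfolding depth_def
  proof (rule the_equality[where P = "\<lambda>n. ((\<lambda>x y. \<exists>i. arr i x y) ^^ n) (qcoset V L v) b", OF n])
    fix k assume "((\<lambda>x y. \<exists>i. arr i x y) ^^ k) (qcoset V L v) b"
    from len[OF this] len[OF n] show "k = n" by simp
  qed
  with len[OF n] show ?thesis by simp
qed

end

theorem proposition7p3:
  fixes D :: "('i::finite, 'r::finite) root_datum"
    and V :: "('i, 'r, 'm::ab_group_add) uq_module"
    and \<Lambda> \<rho> :: "complex^'r"
    and w :: "complex^'r \<Rightarrow> complex^'r"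
    and v :: 'm and L b :: "'m set" and B :: "'m set set"
  defines "arr \<equiv> crystal_arrow D V L B"
    and "b\<^sub>0 \<equiv> qcoset V L v"
  assumes "kac_moody_datum D"
    and "finite_type (cartan D) \<or> affine_type (cartan D)"
    and "\<Lambda> \<in> dominant_weights D"
    and "\<forall>i. pairing (simple_root D i) \<rho> = 1"
    and "irreducible_hw_module D V \<Lambda> v"
    and "hw_crystal_base D V v L B"
    and "b \<in> weyl_orbit D arr b\<^sub>0"
    and "w \<in> weyl_group D"
    and "weyl_acts D arr w b\<^sub>0 b"
  shows "atomic_length \<rho> \<Lambda> w = of_nat (depth arr b\<^sub>0 b)"
proof -
  interpret integrable_uq_module D V
    using assms(3,7) by unfold_locales (simp_all add: irreducible_hw_module_def)
  interpret hw_crystal D V \<Lambda> v L B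
    using assms(7,8) by unfold_locales (simp_all add: irreducible_hw_module_def)
  \<comment> \<open>The weight of b is the only link needed between w and the crystal: both sides of
    the claim are now read off from it.\<close>
  have "b \<in> B \<and> has_weight b (w \<Lambda>)"
    using weyl_acts_weight[OF _ highest_weight_vertex] assms(11) unfolding arr_def b\<^sub>0_def .
  then show ?thesis
    using depth_eq[of \<rho> b "w \<Lambda>"] assms(6) by (simp add: atomic_length_def arr_def b\<^sub>0_def)
qed

end
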